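(* Let $p$ be a prime, $q$ a positive power of $p$, $X$ a Noetherian $F$-finite $\mathbf{F}_p$-scheme, and $\mathcal{I}\subset\mathcal{O}_X$ a quasi-coherent ideal sheaf that is locally generated by a single element. Let $(M,C)$ be a coherent $q$-Cartier module on $X$ and let $N\subset M$ be a coherent $\mathcal{O}_X$-submodule. Assume that there exists a constant $L\ge0$ such that $\#\bigl(\nu_{\mathcal{I}}(q^m;N)\cap[0,q^m)\bigr)\le L$ for all integers $m\ge1$. Then the set $\nu_{\mathcal{I}}(q^\infty;N)\subset\mathbf{Z}_p$ is finite.
   Context: An $\mathbf{F}_p$-scheme is $F$-finite if its Frobenius is finite. A $q$-Cartier module on $X$ is a pair $(M,C)$ with $M$ an $\mathcal{O}_X$-module and $C\colon M\to M$ an additive endomorphism with $C(a^qx)=aC(x)$ for all local sections $a\in\mathcal{O}_X$, $x\in M$. It is coherent if $M$ is coherent over $\mathcal{O}_X$. For an $\mathcal{O}_X$-submodule $N\subset M$ and $m\ge1$, $$\nu_{\mathcal{I}}(q^m;N)=\{n\in\mathbf{Z}_{\ge0}\mid C^m(\mathcal{I}^nN)\ne C^m(\mathcal{I}^{n+1}N)\}.$$ $\nu_{\mathcal{I}}(q^\infty;N)$ is the set of all $\alpha\in\mathbf{Z}_p$ such that for every integer $m\ge1$ there is $n\in\nu_{\mathcal{I}}(q^m;N)$ with $\alpha-n\in q^m\mathbf{Z}_p$. *)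

theory Defs
  imports
    "HOL-Analysis.Abstract_Topology"
    "HOL-Algebra.Ring_Divisibility"
    "HOL-Algebra.QuotRing"
    "HOL-Computational_Algebra.Primes"
begin

section \<open>Sheaves on a topological space\<close>

text \<open>
  A presheaf is given by its sets of sections \<^term>\<open>F U\<close> and its restriction maps
  \<^term>\<open>r U V\<close> from \<^term>\<open>F U\<close> to \<^term>\<open>F V\<close>.  Both are total functions; only their values on
  open sets (and, for \<^term>\<open>r\<close>, on sections) carry meaning, and everything below is insensitive
  to the other values.
\<close>

definition sheaf_of_sets ::
    "'a topology \<Rightarrow> ('a set \<Rightarrow> 'c set) \<Rightarrow> ('a set \<Rightarrow> 'a set \<Rightarrow> 'c \<Rightarrow> 'c) \<Rightarrow> bool" where
  "sheaf_of_sets T F r \<longleftrightarrow>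
     (\<forall>U V. openin T U \<and> openin T V \<and> V \<subseteq> U \<longrightarrow> r U V \<in> F U \<rightarrow> F V) \<and>
     (\<forall>U. openin T U \<longrightarrow> (\<forall>x\<in>F U. r U U x = x)) \<and>
     (\<forall>U V W. openin T U \<and> openin T V \<and> openin T W \<and> V \<subseteq> U \<and> W \<subseteq> V \<longrightarrow>
        (\<forall>x\<in>F U. r V W (r U V x) = r U W x)) \<and>
     (\<forall>\<V>. (\<forall>V\<in>\<V>. openin T V) \<longrightarrow>
        (\<forall>x\<in>F (\<Union>\<V>). \<forall>y\<in>F (\<Union>\<V>). (\<forall>V\<in>\<V>. r (\<Union>\<V>) V x = r (\<Union>\<V>) V y) \<longrightarrow> x = y)) \<and>
     (\<forall>\<V> s. (\<forall>V\<in>\<V>. openin T V \<and> s V \<in> F V) \<and>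
        (\<forall>V\<in>\<V>. \<forall>W\<in>\<V>. r V (V \<inter> W) (s V) = r W (V \<inter> W) (s W)) \<longrightarrow>
        (\<exists>x\<in>F (\<Union>\<V>). \<forall>V\<in>\<V>. r (\<Union>\<V>) V x = s V))"

text \<open>
  The subsheaf of a sheaf \<^term>\<open>F\<close> generated by a subpresheaf \<^term>\<open>P\<close> (the sheafification of
  \<^term>\<open>P\<close>, computed inside \<^term>\<open>F\<close>): the sections that locally belong to \<^term>\<open>P\<close>.
\<close>

definition generated_subsheaf ::
    "'a topology \<Rightarrow> ('a set \<Rightarrow> 'c set) \<Rightarrow> ('a set \<Rightarrow> 'a set \<Rightarrow> 'c \<Rightarrow> 'c) \<Rightarrow>
     ('a set \<Rightarrow> 'c set) \<Rightarrow> 'a set \<Rightarrow> 'c set" where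
  "generated_subsheaf T F r P U =
     {s \<in> F U. \<forall>x\<in>U. \<exists>W. openin T W \<and> x \<in> W \<and> W \<subseteq> U \<and> r U W s \<in> P W}"

section \<open>Ringed spaces and their morphisms\<close>

record ('a, 'b) ringed_space =
  space_of :: "'a topology"
  ring_of :: "'a set \<Rightarrow> 'b ring"
  res_of :: "'a set \<Rightarrow> 'a set \<Rightarrow> 'b \<Rightarrow> 'b"

definition is_ringed_space :: "('a, 'b) ringed_space \<Rightarrow> bool" where
  "is_ringed_space X \<longleftrightarrow>
     sheaf_of_sets (space_of X) (\<lambda>U. carrier (ring_of X U)) (res_of X) \<and>
     (\<forall>U. openin (space_of X) U \<longrightarrow> cring (ring_of X U)) \<and>
     (\<forall>U V. openin (space_of X) U \<and> openin (space_of X) V \<and> V \<subseteq> U \<longrightarrow>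
        res_of X U V \<in> ring_hom (ring_of X U) (ring_of X V))"

definition open_subspace :: "('a, 'b) ringed_space \<Rightarrow> 'a set \<Rightarrow> ('a, 'b) ringed_space" where
  "open_subspace X U = X\<lparr>space_of := subtopology (space_of X) U\<rparr>"

definition preim :: "('a, 'b) ringed_space \<Rightarrow> ('a \<Rightarrow> 'c) \<Rightarrow> 'c set \<Rightarrow> 'a set" where
  "preim X f V = {x \<in> topspace (space_of X). f x \<in> V}"

text \<open>
  A morphism from \<^term>\<open>X\<close> to \<^term>\<open>Y\<close> is a continuous map \<^term>\<open>f\<close> together with compatible ring
  homomorphisms \<^term>\<open>\<phi> V\<close> from the sections of \<^term>\<open>Y\<close> over \<^term>\<open>V\<close> to the sections of
  \<^term>\<open>X\<close> over the preimage of \<^term>\<open>V\<close>.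
\<close>

definition ringed_space_morphism ::
    "('a, 'b) ringed_space \<Rightarrow> ('c, 'd) ringed_space \<Rightarrow> ('a \<Rightarrow> 'c) \<Rightarrow> ('c set \<Rightarrow> 'd \<Rightarrow> 'b) \<Rightarrow> bool" where
  "ringed_space_morphism X Y f \<phi> \<longleftrightarrow>
     continuous_map (space_of X) (space_of Y) f \<and>
     (\<forall>V. openin (space_of Y) V \<longrightarrow> \<phi> V \<in> ring_hom (ring_of Y V) (ring_of X (preim X f V))) \<and>
     (\<forall>V W. openin (space_of Y) V \<and> openin (space_of Y) W \<and> W \<subseteq> V \<longrightarrow>
        (\<forall>b\<in>carrier (ring_of Y V).
           \<phi> W (res_of Y V W b) = res_of X (preim X f V) (preim X f W) (\<phi> V b)))"

definition ringed_space_iso ::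
    "('a, 'b) ringed_space \<Rightarrow> ('c, 'd) ringed_space \<Rightarrow> ('a \<Rightarrow> 'c) \<Rightarrow> ('c set \<Rightarrow> 'd \<Rightarrow> 'b) \<Rightarrow> bool" where
  "ringed_space_iso X Y f \<phi> \<longleftrightarrow>
     ringed_space_morphism X Y f \<phi> \<and>
     homeomorphic_map (space_of X) (space_of Y) f \<and>
     (\<forall>V. openin (space_of Y) V \<longrightarrow> \<phi> V \<in> ring_iso (ring_of Y V) (ring_of X (preim X f V)))"

definition germ_unit :: "('a, 'b) ringed_space \<Rightarrow> 'a \<Rightarrow> 'a set \<Rightarrow> 'b \<Rightarrow> bool" where
  "germ_unit X x U a \<longleftrightarrow>
     (\<exists>W. openin (space_of X) W \<and> x \<in> W \<and> W \<subseteq> U \<and> res_of X U W a \<in> Units (ring_of X W))"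

text \<open>
  The second conjunct says, without mentioning stalks as rings, that the maps induced on stalks
  are local: a germ whose image is a unit is itself a unit.
\<close>

definition scheme_morphism ::
    "('a, 'b) ringed_space \<Rightarrow> ('c, 'd) ringed_space \<Rightarrow> ('a \<Rightarrow> 'c) \<Rightarrow> ('c set \<Rightarrow> 'd \<Rightarrow> 'b) \<Rightarrow> bool" where
  "scheme_morphism X Y f \<phi> \<longleftrightarrow>
     ringed_space_morphism X Y f \<phi> \<and>
     (\<forall>V. openin (space_of Y) V \<longrightarrow> (\<forall>x\<in>preim X f V. \<forall>b\<in>carrier (ring_of Y V).
        germ_unit X x (preim X f V) (\<phi> V b) \<longrightarrow> germ_unit Y (f x) V b))"

section \<open>Localization\<close>

text \<open>
  The fraction \<open>m/s\<close> of the localization of an \<^term>\<open>A\<close>-module \<^term>\<open>M\<close> at a multiplicative set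
  \<^term>\<open>S\<close>, as an equivalence class of pairs.
\<close>

definition fraction ::
    "'b ring \<Rightarrow> ('b, 'c) module \<Rightarrow> 'b set \<Rightarrow> 'c \<Rightarrow> 'b \<Rightarrow> ('c \<times> 'b) set" where
  "fraction A M S m s =
     {(n, t). n \<in> carrier M \<and> t \<in> S \<and>
        (\<exists>u\<in>S. u \<odot>\<^bsub>M\<^esub> (t \<odot>\<^bsub>M\<^esub> m) = u \<odot>\<^bsub>M\<^esub> (s \<odot>\<^bsub>M\<^esub> n))}"

definition self_module :: "'b ring \<Rightarrow> ('b, 'b) module" where
  "self_module A =
     \<lparr>carrier = carrier A, mult = mult A, one = one A, zero = zero A, add = add A, smult = mult A\<rparr>"

text \<open>
  In the next two definitions the unions run over all representatives; since the operations on
  fractions are well defined, all members of such a union coincide.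
\<close>

definition frac_add ::
    "'b ring \<Rightarrow> ('b, 'c) module \<Rightarrow> 'b set \<Rightarrow> ('c \<times> 'b) set \<Rightarrow> ('c \<times> 'b) set \<Rightarrow> ('c \<times> 'b) set" where
  "frac_add A M S x y =
     (\<Union>(m, s)\<in>x. \<Union>(n, t)\<in>y. fraction A M S (t \<odot>\<^bsub>M\<^esub> m \<oplus>\<^bsub>M\<^esub> s \<odot>\<^bsub>M\<^esub> n) (s \<otimes>\<^bsub>A\<^esub> t))"

definition frac_smult ::
    "'b ring \<Rightarrow> ('b, 'c) module \<Rightarrow> 'b set \<Rightarrow> ('b \<times> 'b) set \<Rightarrow> ('c \<times> 'b) set \<Rightarrow> ('c \<times> 'b) set" where
  "frac_smult A M S x y =
     (\<Union>(a, s)\<in>x. \<Union>(m, t)\<in>y. fraction A M S (a \<odot>\<^bsub>M\<^esub> m) (s \<otimes>\<^bsub>A\<^esub> t))"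

definition localization :: "'b ring \<Rightarrow> 'b set \<Rightarrow> ('b \<times> 'b) set ring" where
  "localization A S =
     \<lparr>carrier = {fraction A (self_module A) S a s | a s. a \<in> carrier A \<and> s \<in> S},
      mult = frac_smult A (self_module A) S,
      one = fraction A (self_module A) S \<one>\<^bsub>A\<^esub> \<one>\<^bsub>A\<^esub>,
      zero = fraction A (self_module A) S \<zero>\<^bsub>A\<^esub> \<one>\<^bsub>A\<^esub>,
      add = frac_add A (self_module A) S\<rparr>"

text \<open>The \<^const>\<open>mult\<close> and \<^const>\<open>one\<close> fields of a module record are irrelevant.\<close>

definition localization_module ::
    "'b ring \<Rightarrow> ('b, 'c) module \<Rightarrow> 'b set \<Rightarrow> (('b \<times> 'b) set, ('c \<times> 'b) set) module" where
  "localization_module A M S =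
     \<lparr>carrier = {fraction A M S m s | m s. m \<in> carrier M \<and> s \<in> S},
      mult = undefined,
      one = undefined,
      zero = fraction A M S \<zero>\<^bsub>M\<^esub> \<one>\<^bsub>A\<^esub>,
      add = frac_add A M S,
      smult = frac_smult A M S\<rparr>"

section \<open>Affine schemes and the sheaf associated with a module\<close>

definition spec_points :: "'b ring \<Rightarrow> 'b set set" where
  "spec_points A = {P. primeideal P A}"

definition spec_topology :: "'b ring \<Rightarrow> 'b set topology" where
  "spec_topology A = topology_generated_by {{P \<in> spec_points A. a \<notin> P} | a. a \<in> carrier A}"

text \<open>
  Sections over \<^term>\<open>U\<close> are the functions assigning to each prime \<^term>\<open>P\<close> in \<^term>\<open>U\<close> an element
  of the localization at \<^term>\<open>P\<close> that are locally given by a single fraction.  They are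
  normalized to be \<^const>\<open>undefined\<close> outside \<^term>\<open>U\<close>.
\<close>

definition tilde_sections :: "'b ring \<Rightarrow> ('b, 'c) module \<Rightarrow> 'b set set \<Rightarrow> ('b set \<Rightarrow> ('c \<times> 'b) set) set" where
  "tilde_sections A M U =
     {\<sigma> \<in> (\<Pi>\<^sub>E P\<in>U. carrier (localization_module A M (carrier A - P))).
        \<forall>P\<in>U. \<exists>V. openin (spec_topology A) V \<and> P \<in> V \<and> V \<subseteq> U \<and>
          (\<exists>m\<in>carrier M. \<exists>s\<in>carrier A. \<forall>Q\<in>V. s \<notin> Q \<and> \<sigma> Q = fraction A M (carrier A - Q) m s)}"

definition spec_ring :: "'b ring \<Rightarrow> 'b set set \<Rightarrow> ('b set \<Rightarrow> ('b \<times> 'b) set) ring" where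
  "spec_ring A U =
     \<lparr>carrier = tilde_sections A (self_module A) U,
      mult = (\<lambda>\<sigma> \<tau>. \<lambda>P\<in>U. \<sigma> P \<otimes>\<^bsub>localization A (carrier A - P)\<^esub> \<tau> P),
      one = (\<lambda>P\<in>U. \<one>\<^bsub>localization A (carrier A - P)\<^esub>),
      zero = (\<lambda>P\<in>U. \<zero>\<^bsub>localization A (carrier A - P)\<^esub>),
      add = (\<lambda>\<sigma> \<tau>. \<lambda>P\<in>U. \<sigma> P \<oplus>\<^bsub>localization A (carrier A - P)\<^esub> \<tau> P)\<rparr>"

definition Spec :: "'b ring \<Rightarrow> ('b set, 'b set \<Rightarrow> ('b \<times> 'b) set) ringed_space" where
  "Spec A = \<lparr>space_of = spec_topology A, ring_of = spec_ring A, res_of = (\<lambda>U V \<sigma>. restrict \<sigma> V)\<rparr>"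

record ('a, 'b, 'c) module_sheaf =
  module_of :: "'a set \<Rightarrow> ('b, 'c) module"
  mres_of :: "'a set \<Rightarrow> 'a set \<Rightarrow> 'c \<Rightarrow> 'c"

definition tilde ::
    "'b ring \<Rightarrow> ('b, 'c) module \<Rightarrow>
     ('b set, 'b set \<Rightarrow> ('b \<times> 'b) set, 'b set \<Rightarrow> ('c \<times> 'b) set) module_sheaf" where
  "tilde A M =
     \<lparr>module_of = (\<lambda>U.
        \<lparr>carrier = tilde_sections A M U,
         mult = undefined,
         one = undefined,
         zero = (\<lambda>P\<in>U. \<zero>\<^bsub>localization_module A M (carrier A - P)\<^esub>),
         add = (\<lambda>\<sigma> \<tau>. \<lambda>P\<in>U. \<sigma> P \<oplus>\<^bsub>localization_module A M (carrier A - P)\<^esub> \<tau> P),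
         smult = (\<lambda>\<sigma> \<tau>. \<lambda>P\<in>U. \<sigma> P \<odot>\<^bsub>localization_module A M (carrier A - P)\<^esub> \<tau> P)\<rparr>),
      mres_of = (\<lambda>U V \<sigma>. restrict \<sigma> V)\<rparr>"

section \<open>Schemes\<close>

text \<open>
  The ring of an affine chart may be taken over the type of sections of \<^term>\<open>X\<close>, because it is
  isomorphic to the ring of sections of \<^term>\<open>X\<close> over \<^term>\<open>U\<close>.
\<close>

definition affine_chart ::
    "('a, 'b) ringed_space \<Rightarrow> 'a set \<Rightarrow> 'b ring \<Rightarrow> ('a \<Rightarrow> 'b set) \<Rightarrow>
     ('b set set \<Rightarrow> ('b set \<Rightarrow> ('b \<times> 'b) set) \<Rightarrow> 'b) \<Rightarrow> bool" where
  "affine_chart X U A f \<phi> \<longleftrightarrow>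
     openin (space_of X) U \<and> cring A \<and> ringed_space_iso (open_subspace X U) (Spec A) f \<phi>"

definition affine_open :: "('a, 'b) ringed_space \<Rightarrow> 'a set \<Rightarrow> bool" where
  "affine_open X U \<longleftrightarrow> (\<exists>A f \<phi>. affine_chart X U A f \<phi>)"

text \<open>
  A scheme is a ringed space that is locally isomorphic to a spectrum.  Its stalks are then
  automatically local rings, and an isomorphism of ringed spaces with a spectrum is automatically
  an isomorphism of locally ringed spaces.
\<close>

definition is_scheme :: "('a, 'b) ringed_space \<Rightarrow> bool" where
  "is_scheme X \<longleftrightarrow>
     is_ringed_space X \<and> (\<forall>x\<in>topspace (space_of X). \<exists>U. x \<in> U \<and> affine_open X U)"

definition locally_noetherian :: "('a, 'b) ringed_space \<Rightarrow> bool" where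
  "locally_noetherian X \<longleftrightarrow>
     (\<forall>x\<in>topspace (space_of X). \<exists>U A f \<phi>. x \<in> U \<and> affine_chart X U A f \<phi> \<and> noetherian_ring A)"

definition noetherian_scheme :: "('a, 'b) ringed_space \<Rightarrow> bool" where
  "noetherian_scheme X \<longleftrightarrow> is_scheme X \<and> locally_noetherian X \<and> compact_space (space_of X)"

definition Fp_scheme :: "nat \<Rightarrow> ('a, 'b) ringed_space \<Rightarrow> bool" where
  "Fp_scheme p X \<longleftrightarrow>
     is_scheme X \<and>
     (\<forall>U. openin (space_of X) U \<longrightarrow> [p] \<cdot>\<^bsub>ring_of X U\<^esub> \<one>\<^bsub>ring_of X U\<^esub> = \<zero>\<^bsub>ring_of X U\<^esub>)"

definition finite_ring_map :: "'d ring \<Rightarrow> 'b ring \<Rightarrow> ('d \<Rightarrow> 'b) \<Rightarrow> bool" where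
  "finite_ring_map B A h \<longleftrightarrow>
     h \<in> ring_hom B A \<and>
     (\<exists>G. finite G \<and> G \<subseteq> carrier A \<and>
       (\<forall>a\<in>carrier A. \<exists>c\<in>G \<rightarrow> carrier B. a = (\<Oplus>\<^bsub>A\<^esub>g\<in>G. h (c g) \<otimes>\<^bsub>A\<^esub> g)))"

definition finite_morphism ::
    "('a, 'b) ringed_space \<Rightarrow> ('c, 'd) ringed_space \<Rightarrow> ('a \<Rightarrow> 'c) \<Rightarrow> ('c set \<Rightarrow> 'd \<Rightarrow> 'b) \<Rightarrow> bool" where
  "finite_morphism X Y f \<phi> \<longleftrightarrow>
     scheme_morphism X Y f \<phi> \<and>
     (\<forall>y\<in>topspace (space_of Y). \<exists>V. y \<in> V \<and> affine_open Y V \<and> affine_open X (preim X f V) \<and>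
        finite_ring_map (ring_of Y V) (ring_of X (preim X f V)) (\<phi> V))"

definition frobenius :: "nat \<Rightarrow> ('a, 'b) ringed_space \<Rightarrow> 'a set \<Rightarrow> 'b \<Rightarrow> 'b" where
  "frobenius p X U a = a [^]\<^bsub>ring_of X U\<^esub> p"

definition F_finite :: "nat \<Rightarrow> ('a, 'b) ringed_space \<Rightarrow> bool" where
  "F_finite p X \<longleftrightarrow> Fp_scheme p X \<and> finite_morphism X X id (frobenius p X)"

section \<open>Sheaves of modules\<close>

definition is_module_sheaf :: "('a, 'b) ringed_space \<Rightarrow> ('a, 'b, 'c) module_sheaf \<Rightarrow> bool" where
  "is_module_sheaf X M \<longleftrightarrow>
     sheaf_of_sets (space_of X) (\<lambda>U. carrier (module_of M U)) (mres_of M) \<and>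
     (\<forall>U. openin (space_of X) U \<longrightarrow> Module.module (ring_of X U) (module_of M U)) \<and>
     (\<forall>U V. openin (space_of X) U \<and> openin (space_of X) V \<and> V \<subseteq> U \<longrightarrow>
        (\<forall>x\<in>carrier (module_of M U). \<forall>y\<in>carrier (module_of M U).
           mres_of M U V (x \<oplus>\<^bsub>module_of M U\<^esub> y) =
             mres_of M U V x \<oplus>\<^bsub>module_of M V\<^esub> mres_of M U V y) \<and>
        (\<forall>a\<in>carrier (ring_of X U). \<forall>x\<in>carrier (module_of M U).
           mres_of M U V (a \<odot>\<^bsub>module_of M U\<^esub> x) =
             res_of X U V a \<odot>\<^bsub>module_of M V\<^esub> mres_of M U V x))"

definition structure_module :: "('a, 'b) ringed_space \<Rightarrow> ('a, 'b, 'b) module_sheaf" where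
  "structure_module X = \<lparr>module_of = (\<lambda>U. self_module (ring_of X U)), mres_of = res_of X\<rparr>"

text \<open>A subsheaf of modules is given by its sets of sections.\<close>

definition is_submodule_sheaf ::
    "('a, 'b) ringed_space \<Rightarrow> ('a, 'b, 'c) module_sheaf \<Rightarrow> ('a set \<Rightarrow> 'c set) \<Rightarrow> bool" where
  "is_submodule_sheaf X M N \<longleftrightarrow>
     (\<forall>U. openin (space_of X) U \<longrightarrow> submodule (N U) (ring_of X U) (module_of M U)) \<and>
     (\<forall>U V. openin (space_of X) U \<and> openin (space_of X) V \<and> V \<subseteq> U \<longrightarrow>
        mres_of M U V \<in> N U \<rightarrow> N V) \<and>
     (\<forall>U. openin (space_of X) U \<longrightarrow>
        generated_subsheaf (space_of X) (\<lambda>U. carrier (module_of M U)) (mres_of M) N U \<subseteq> N U)"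

definition submodule_as_sheaf ::
    "('a, 'b, 'c) module_sheaf \<Rightarrow> ('a set \<Rightarrow> 'c set) \<Rightarrow> ('a, 'b, 'c) module_sheaf" where
  "submodule_as_sheaf M N = M\<lparr>module_of := (\<lambda>U. (module_of M U)\<lparr>carrier := N U\<rparr>)\<rparr>"

text \<open>
  \<^term>\<open>\<psi>\<close> identifies, along the chart \<^term>\<open>(f, \<phi>)\<close> of \<^term>\<open>U\<close>, the sheaf associated with the
  \<^term>\<open>A\<close>-module \<^term>\<open>E\<close> with the restriction of \<^term>\<open>F\<close> to \<^term>\<open>U\<close>.
\<close>

definition tilde_iso ::
    "('a, 'b) ringed_space \<Rightarrow> 'a set \<Rightarrow> 'b ring \<Rightarrow> ('a \<Rightarrow> 'b set) \<Rightarrow>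
     ('b set set \<Rightarrow> ('b set \<Rightarrow> ('b \<times> 'b) set) \<Rightarrow> 'b) \<Rightarrow>
     ('a, 'b, 'c) module_sheaf \<Rightarrow> ('b, 'c) module \<Rightarrow>
     ('b set set \<Rightarrow> ('b set \<Rightarrow> ('c \<times> 'b) set) \<Rightarrow> 'c) \<Rightarrow> bool" where
  "tilde_iso X U A f \<phi> F E \<psi> \<longleftrightarrow>
     (\<forall>V. openin (spec_topology A) V \<longrightarrow>
        (let E' = module_of (tilde A E) V;
             F' = module_of F (preim (open_subspace X U) f V)
         in bij_betw (\<psi> V) (carrier E') (carrier F') \<and>
            (\<forall>\<sigma>\<in>carrier E'. \<forall>\<tau>\<in>carrier E'. \<psi> V (\<sigma> \<oplus>\<^bsub>E'\<^esub> \<tau>) = \<psi> V \<sigma> \<oplus>\<^bsub>F'\<^esub> \<psi> V \<tau>) \<and>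
            (\<forall>\<alpha>\<in>carrier (spec_ring A V). \<forall>\<sigma>\<in>carrier E'.
               \<psi> V (\<alpha> \<odot>\<^bsub>E'\<^esub> \<sigma>) = \<phi> V \<alpha> \<odot>\<^bsub>F'\<^esub> \<psi> V \<sigma>))) \<and>
     (\<forall>V W. openin (spec_topology A) V \<and> openin (spec_topology A) W \<and> W \<subseteq> V \<longrightarrow>
        (\<forall>\<sigma>\<in>tilde_sections A E V.
           \<psi> W (mres_of (tilde A E) V W \<sigma>) =
             mres_of F (preim (open_subspace X U) f V) (preim (open_subspace X U) f W) (\<psi> V \<sigma>)))"

definition fin_gen_module :: "'b ring \<Rightarrow> ('b, 'c) module \<Rightarrow> bool" where
  "fin_gen_module A E \<longleftrightarrow>
     (\<exists>G. finite G \<and> G \<subseteq> carrier E \<and>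
       (\<forall>x\<in>carrier E. \<exists>c\<in>G \<rightarrow> carrier A. x = (\<Oplus>\<^bsub>E\<^esub>g\<in>G. c g \<odot>\<^bsub>E\<^esub> g)))"

definition quasi_coherent :: "('a, 'b) ringed_space \<Rightarrow> ('a, 'b, 'c) module_sheaf \<Rightarrow> bool" where
  "quasi_coherent X F \<longleftrightarrow>
     is_module_sheaf X F \<and>
     (\<forall>x\<in>topspace (space_of X). \<exists>U A f \<phi> E \<psi>.
        x \<in> U \<and> affine_chart X U A f \<phi> \<and> Module.module A E \<and> tilde_iso X U A f \<phi> F E \<psi>)"

text \<open>The usual definition of coherence on a Noetherian scheme.\<close>

definition coherent :: "('a, 'b) ringed_space \<Rightarrow> ('a, 'b, 'c) module_sheaf \<Rightarrow> bool" where
  "coherent X F \<longleftrightarrow>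
     is_module_sheaf X F \<and>
     (\<forall>x\<in>topspace (space_of X). \<exists>U A f \<phi> E \<psi>.
        x \<in> U \<and> affine_chart X U A f \<phi> \<and> Module.module A E \<and> fin_gen_module A E \<and>
        tilde_iso X U A f \<phi> F E \<psi>)"

section \<open>Ideal sheaves\<close>

definition is_ideal_sheaf :: "('a, 'b) ringed_space \<Rightarrow> ('a set \<Rightarrow> 'b set) \<Rightarrow> bool" where
  "is_ideal_sheaf X I \<longleftrightarrow> is_submodule_sheaf X (structure_module X) I"

definition quasi_coherent_ideal :: "('a, 'b) ringed_space \<Rightarrow> ('a set \<Rightarrow> 'b set) \<Rightarrow> bool" where
  "quasi_coherent_ideal X I \<longleftrightarrow>
     is_ideal_sheaf X I \<and> quasi_coherent X (submodule_as_sheaf (structure_module X) I)"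

definition locally_principal :: "('a, 'b) ringed_space \<Rightarrow> ('a set \<Rightarrow> 'b set) \<Rightarrow> bool" where
  "locally_principal X I \<longleftrightarrow>
     (\<forall>x\<in>topspace (space_of X). \<exists>U. openin (space_of X) U \<and> x \<in> U \<and>
        (\<exists>g\<in>I U. \<forall>V. openin (space_of X) V \<and> V \<subseteq> U \<longrightarrow>
           I V = generated_subsheaf (space_of X) (\<lambda>W. carrier (ring_of X W)) (res_of X)
                   (\<lambda>W. PIdl\<^bsub>ring_of X W\<^esub> (res_of X U W g)) V))"

text \<open>
  The product of an ideal sheaf \<^term>\<open>J\<close> with a subsheaf of modules \<^term>\<open>N\<close> of \<^term>\<open>M\<close>, that is
  the image of the tensor product of \<^term>\<open>J\<close> and \<^term>\<open>N\<close> in \<^term>\<open>M\<close>.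
\<close>

definition ideal_mult ::
    "('a, 'b) ringed_space \<Rightarrow> ('a, 'b, 'c) module_sheaf \<Rightarrow> ('a set \<Rightarrow> 'b set) \<Rightarrow>
     ('a set \<Rightarrow> 'c set) \<Rightarrow> 'a set \<Rightarrow> 'c set" where
  "ideal_mult X M J N =
     generated_subsheaf (space_of X) (\<lambda>U. carrier (module_of M U)) (mres_of M)
       (\<lambda>U. {\<Oplus>\<^bsub>module_of M U\<^esub>i\<in>{..<k}. a i \<odot>\<^bsub>module_of M U\<^esub> y i | (k :: nat) a y.
               a \<in> {..<k} \<rightarrow> J U \<and> y \<in> {..<k} \<rightarrow> N U})"

primrec ideal_power ::
    "('a, 'b) ringed_space \<Rightarrow> ('a set \<Rightarrow> 'b set) \<Rightarrow> nat \<Rightarrow> 'a set \<Rightarrow> 'b set" where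
  "ideal_power X I 0 = (\<lambda>U. carrier (ring_of X U))"
| "ideal_power X I (Suc n) = ideal_mult X (structure_module X) I (ideal_power X I n)"

section \<open>Cartier modules\<close>

definition cartier_module ::
    "nat \<Rightarrow> ('a, 'b) ringed_space \<Rightarrow> ('a, 'b, 'c) module_sheaf \<Rightarrow> ('a set \<Rightarrow> 'c \<Rightarrow> 'c) \<Rightarrow> bool" where
  "cartier_module q X M C \<longleftrightarrow>
     is_module_sheaf X M \<and>
     (\<forall>U. openin (space_of X) U \<longrightarrow>
        C U \<in> carrier (module_of M U) \<rightarrow> carrier (module_of M U) \<and>
        (\<forall>x\<in>carrier (module_of M U). \<forall>y\<in>carrier (module_of M U).
           C U (x \<oplus>\<^bsub>module_of M U\<^esub> y) = C U x \<oplus>\<^bsub>module_of M U\<^esub> C U y) \<and>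
        (\<forall>a\<in>carrier (ring_of X U). \<forall>x\<in>carrier (module_of M U).
           C U ((a [^]\<^bsub>ring_of X U\<^esub> q) \<odot>\<^bsub>module_of M U\<^esub> x) = a \<odot>\<^bsub>module_of M U\<^esub> C U x)) \<and>
     (\<forall>U V. openin (space_of X) U \<and> openin (space_of X) V \<and> V \<subseteq> U \<longrightarrow>
        (\<forall>x\<in>carrier (module_of M U). mres_of M U V (C U x) = C V (mres_of M U V x)))"

text \<open>The image sheaf of \<^term>\<open>N\<close> under the \<^term>\<open>m\<close>-th iterate of \<^term>\<open>C\<close>.\<close>

definition cartier_image ::
    "('a, 'b) ringed_space \<Rightarrow> ('a, 'b, 'c) module_sheaf \<Rightarrow> ('a set \<Rightarrow> 'c \<Rightarrow> 'c) \<Rightarrow> nat \<Rightarrow>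
     ('a set \<Rightarrow> 'c set) \<Rightarrow> 'a set \<Rightarrow> 'c set" where
  "cartier_image X M C m N =
     generated_subsheaf (space_of X) (\<lambda>U. carrier (module_of M U)) (mres_of M)
       (\<lambda>U. (C U ^^ m) ` N U)"

definition nu ::
    "('a, 'b) ringed_space \<Rightarrow> ('a, 'b, 'c) module_sheaf \<Rightarrow> ('a set \<Rightarrow> 'c \<Rightarrow> 'c) \<Rightarrow>
     ('a set \<Rightarrow> 'b set) \<Rightarrow> ('a set \<Rightarrow> 'c set) \<Rightarrow> nat \<Rightarrow> nat set" where
  "nu X M C I N m =
     {n. \<exists>U. openin (space_of X) U \<and>
        cartier_image X M C m (ideal_mult X M (ideal_power X I n) N) U \<noteq>
        cartier_image X M C m (ideal_mult X M (ideal_power X I (n + 1)) N) U}"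

section \<open>The ring of p-adic integers\<close>

text \<open>
  The inverse limit of the rings of integers modulo \<open>p ^ k\<close>, with residue classes represented by
  their least nonnegative members.
\<close>

definition padic_int :: "nat \<Rightarrow> (nat \<Rightarrow> int) ring" where
  "padic_int p =
     \<lparr>carrier = {x. \<forall>k. 0 \<le> x k \<and> x k < int p ^ k \<and> x (Suc k) mod int p ^ k = x k},
      mult = (\<lambda>x y k. (x k * y k) mod int p ^ k),
      one = (\<lambda>k. 1 mod int p ^ k),
      zero = (\<lambda>k. 0),
      add = (\<lambda>x y k. (x k + y k) mod int p ^ k)\<rparr>"

definition nu_infinity ::
    "nat \<Rightarrow> nat \<Rightarrow> ('a, 'b) ringed_space \<Rightarrow> ('a, 'b, 'c) module_sheaf \<Rightarrow> ('a set \<Rightarrow> 'c \<Rightarrow> 'c) \<Rightarrow>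
     ('a set \<Rightarrow> 'b set) \<Rightarrow> ('a set \<Rightarrow> 'c set) \<Rightarrow> (nat \<Rightarrow> int) set" where
  "nu_infinity p q X M C I N =
     {\<alpha> \<in> carrier (padic_int p). \<forall>m\<ge>1. \<exists>n\<in>nu X M C I N m.
        \<alpha> \<ominus>\<^bsub>padic_int p\<^esub> [n] \<cdot>\<^bsub>padic_int p\<^esub> \<one>\<^bsub>padic_int p\<^esub>
          \<in> PIdl\<^bsub>padic_int p\<^esub> ([(q ^ m)] \<cdot>\<^bsub>padic_int p\<^esub> \<one>\<^bsub>padic_int p\<^esub>)}"

end

theory Submission
  imports Defs
begin

text \<open>
  The set \<open>\<nu>(q\<^sup>m)\<close> of jumps is periodic downwards: if \<open>n \<ge> q\<^sup>m\<close> is a jump, then so is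
  \<open>n - q\<^sup>m\<close>.  Indeed, where the ideal is generated by \<open>g\<close>, its power \<open>I\<^sup>n N\<close> consists locally of
  the multiples \<open>g\<^sup>n y\<close> with \<open>y\<close> in \<open>N\<close>, and semilinearity of \<open>C\<close> gives
  \<open>C\<^sup>m (g\<^sup>k\<^sup>+\<^sup>Q y) = g C\<^sup>m (g\<^sup>k y)\<close> for \<open>Q = q\<^sup>m\<close>, hence \<open>C\<^sup>m (I\<^sup>k\<^sup>+\<^sup>Q N) = I C\<^sup>m (I\<^sup>k N)\<close>.
  So \<open>C\<^sup>m (I\<^sup>k\<^sup>+\<^sup>Q N)\<close> depends only on \<open>C\<^sup>m (I\<^sup>k N)\<close>, and an equality of consecutive images at
  \<open>k\<close> propagates to \<open>k + Q\<close> (lemmas \<open>power_image_shift\<close> and \<open>nu_shift\<close>).  For an ideal with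
  several generators this can fail, because the power \<open>I\<^sup>Q\<close> can then be larger than the ideal
  generated by the \<open>Q\<close>-th powers.

  Consequently the residue modulo \<open>q\<^sup>m\<close> of a \<open>p\<close>-adic integer in \<open>\<nu>(q\<^sup>\<infinity>)\<close> is itself a jump in
  the interval \<open>[0, q\<^sup>m)\<close>, so that at most \<open>L\<close> residues occur for each \<open>m\<close>.  Since
  \<open>L + 1\<close> distinct \<open>p\<close>-adic integers have distinct residues modulo \<open>q\<^sup>m\<close> for large \<open>m\<close>, the set
  has at most \<open>L\<close> elements.

  The sheaf-theoretic work consists in reading off sections of products, powers and images, which
  are sheafifications of presheaf constructions, on a small neighbourhood of a point
  (lemma \<open>power_image_germ\<close>).
\<close>

section \<open>Germs of sections\<close>

text \<open>
  Membership of the germ of a section at \<^term>\<open>x\<close> in the stalk of a subpresheaf \<^term>\<open>P\<close>.  The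
  domain \<^term>\<open>U\<close> of the section has to be an argument, because the restriction maps take it.
\<close>
definition germ_in ::
    "'a topology \<Rightarrow> ('a set \<Rightarrow> 'a set \<Rightarrow> 'c \<Rightarrow> 'c) \<Rightarrow> ('a set \<Rightarrow> 'c set) \<Rightarrow> 'a \<Rightarrow> 'a set \<Rightarrow> 'c \<Rightarrow> bool" where
  "germ_in T r P x U s \<longleftrightarrow> (\<exists>W. openin T W \<and> x \<in> W \<and> W \<subseteq> U \<and> r U W s \<in> P W)"

lemma generated_subsheaf_iff:
  "s \<in> generated_subsheaf T F r P U \<longleftrightarrow> s \<in> F U \<and> (\<forall>x\<in>U. germ_in T r P x U s)"
  by (auto simp: generated_subsheaf_def germ_in_def)

text \<open>
  The presheaf \<open>g\<^sup>n N\<close> for a function \<^term>\<open>g\<close> on \<^term>\<open>U\<close>.  It is empty over open sets that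
  are not contained in \<^term>\<open>U\<close>, so that a germ in this presheaf is automatically realized inside
  \<^term>\<open>U\<close>.
\<close>
definition power_multiples ::
    "('a, 'b) ringed_space \<Rightarrow> ('a, 'b, 'c) module_sheaf \<Rightarrow> 'a set \<Rightarrow> 'b \<Rightarrow> nat \<Rightarrow>
     ('a set \<Rightarrow> 'c set) \<Rightarrow> 'a set \<Rightarrow> 'c set" where
  "power_multiples X M U g n N W =
     {(res_of X U W g [^]\<^bsub>ring_of X W\<^esub> n) \<odot>\<^bsub>module_of M W\<^esub> y | y. W \<subseteq> U \<and> y \<in> N W}"

locale sheaf_of_modules =
  fixes X :: "('a, 'b) ringed_space"
    and M :: "('a, 'b, 'c) module_sheaf"
  assumes ringed: "is_ringed_space X"
    and module_sheaf: "is_module_sheaf X M"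
begin

abbreviation "is_open \<equiv> openin (space_of X)"
abbreviation "ring_sections U \<equiv> carrier (ring_of X U)"
abbreviation "sections U \<equiv> carrier (module_of M U)"
abbreviation "germ_of \<equiv> germ_in (space_of X) (mres_of M)"
abbreviation "ring_germ_of \<equiv> germ_in (space_of X) (res_of X)"

lemma cring_sections: "is_open U \<Longrightarrow> cring (ring_of X U)"
  using ringed by (auto simp: is_ringed_space_def)

lemma module_sections: "is_open U \<Longrightarrow> Module.module (ring_of X U) (module_of M U)"
  using module_sheaf by (auto simp: is_module_sheaf_def)

lemma res_hom:
  "is_open U \<Longrightarrow> is_open V \<Longrightarrow> V \<subseteq> U \<Longrightarrow> res_of X U V \<in> ring_hom (ring_of X U) (ring_of X V)"
  using ringed by (auto simp: is_ringed_space_def)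

lemma res_closed:
  "is_open U \<Longrightarrow> is_open V \<Longrightarrow> V \<subseteq> U \<Longrightarrow> a \<in> ring_sections U \<Longrightarrow> res_of X U V a \<in> ring_sections V"
  using res_hom ring_hom_closed by metis

lemma res_mult:
  "is_open U \<Longrightarrow> is_open V \<Longrightarrow> V \<subseteq> U \<Longrightarrow> a \<in> ring_sections U \<Longrightarrow> b \<in> ring_sections U \<Longrightarrow>
   res_of X U V (a \<otimes>\<^bsub>ring_of X U\<^esub> b) = res_of X U V a \<otimes>\<^bsub>ring_of X V\<^esub> res_of X U V b"
  using res_hom by (auto simp: ring_hom_def)

lemma res_res:
  "is_open U \<Longrightarrow> is_open V \<Longrightarrow> is_open W \<Longrightarrow> V \<subseteq> U \<Longrightarrow> W \<subseteq> V \<Longrightarrow> a \<in> ring_sections U \<Longrightarrow>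
   res_of X V W (res_of X U V a) = res_of X U W a"
  using ringed by (auto simp: is_ringed_space_def sheaf_of_sets_def)

lemma res_id: "is_open U \<Longrightarrow> a \<in> ring_sections U \<Longrightarrow> res_of X U U a = a"
  using ringed by (auto simp: is_ringed_space_def sheaf_of_sets_def)

lemma res_pow:
  assumes "is_open U" "is_open V" "V \<subseteq> U" "a \<in> ring_sections U"
  shows "res_of X U V (a [^]\<^bsub>ring_of X U\<^esub> n) = res_of X U V a [^]\<^bsub>ring_of X V\<^esub> (n::nat)"
proof -
  interpret R: cring "ring_of X U" by (rule cring_sections[OF assms(1)])
  have "res_of X U V \<one>\<^bsub>ring_of X U\<^esub> = \<one>\<^bsub>ring_of X V\<^esub>"
    using res_hom[OF assms(1-3)] by (auto simp: ring_hom_def)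
  then show ?thesis by (induction n) (simp_all add: res_mult assms)
qed

lemma mres_closed:
  "is_open U \<Longrightarrow> is_open V \<Longrightarrow> V \<subseteq> U \<Longrightarrow> s \<in> sections U \<Longrightarrow> mres_of M U V s \<in> sections V"
  using module_sheaf by (auto simp: is_module_sheaf_def sheaf_of_sets_def Pi_iff)

lemma mres_mres:
  "is_open U \<Longrightarrow> is_open V \<Longrightarrow> is_open W \<Longrightarrow> V \<subseteq> U \<Longrightarrow> W \<subseteq> V \<Longrightarrow> s \<in> sections U \<Longrightarrow>
   mres_of M V W (mres_of M U V s) = mres_of M U W s"
  using module_sheaf by (auto simp: is_module_sheaf_def sheaf_of_sets_def)

lemma mres_id: "is_open U \<Longrightarrow> s \<in> sections U \<Longrightarrow> mres_of M U U s = s"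
  using module_sheaf by (auto simp: is_module_sheaf_def sheaf_of_sets_def)

lemma mres_add:
  "is_open U \<Longrightarrow> is_open V \<Longrightarrow> V \<subseteq> U \<Longrightarrow> s \<in> sections U \<Longrightarrow> t \<in> sections U \<Longrightarrow>
   mres_of M U V (s \<oplus>\<^bsub>module_of M U\<^esub> t) =
     mres_of M U V s \<oplus>\<^bsub>module_of M V\<^esub> mres_of M U V t"
  using module_sheaf by (auto simp: is_module_sheaf_def)

lemma mres_smult:
  "is_open U \<Longrightarrow> is_open V \<Longrightarrow> V \<subseteq> U \<Longrightarrow> a \<in> ring_sections U \<Longrightarrow> s \<in> sections U \<Longrightarrow>
   mres_of M U V (a \<odot>\<^bsub>module_of M U\<^esub> s) = res_of X U V a \<odot>\<^bsub>module_of M V\<^esub> mres_of M U V s"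
  using module_sheaf by (auto simp: is_module_sheaf_def)

lemma mres_zero:
  assumes "is_open U" "is_open V" "V \<subseteq> U"
  shows "mres_of M U V \<zero>\<^bsub>module_of M U\<^esub> = \<zero>\<^bsub>module_of M V\<^esub>"
proof -
  interpret A: Module.module "ring_of X U" "module_of M U" by (rule module_sections[OF assms(1)])
  interpret B: Module.module "ring_of X V" "module_of M V" by (rule module_sections[OF assms(2)])
  let ?z = "mres_of M U V \<zero>\<^bsub>module_of M U\<^esub>"
  have z: "?z \<in> sections V" by (rule mres_closed[OF assms]) simp
  have "?z \<oplus>\<^bsub>module_of M V\<^esub> ?z = ?z"
    using mres_add[OF assms, of "\<zero>\<^bsub>module_of M U\<^esub>" "\<zero>\<^bsub>module_of M U\<^esub>"] by simp
  then show ?thesis using z by simp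
qed

text \<open>
  The neighbourhood that realizes a germ may be chosen inside any given one, and every smaller one
  then does as well.  This is how finitely many germs are brought onto a common neighbourhood.
\<close>
lemma germ_of_restrict:
  assumes P: "\<And>V W. is_open V \<Longrightarrow> is_open W \<Longrightarrow> W \<subseteq> V \<Longrightarrow> mres_of M V W ` P V \<subseteq> P W"
    and U: "is_open U" "is_open V" "x \<in> V" "V \<subseteq> U" "s \<in> sections U"
    and g: "germ_of P x U s"
  shows "\<exists>W. is_open W \<and> x \<in> W \<and> W \<subseteq> V \<and> (\<forall>W'. is_open W' \<and> W' \<subseteq> W \<longrightarrow> mres_of M U W' s \<in> P W')"
proof -
  obtain W where W: "is_open W" "x \<in> W" "W \<subseteq> U" "mres_of M U W s \<in> P W"
    using g by (auto simp: germ_in_def)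
  have "mres_of M U W' s \<in> P W'" if "is_open W'" "W' \<subseteq> W \<inter> V" for W'
    using P[of W W'] that W U mres_mres[of U W W' s] by (auto simp: image_subset_iff)
  then show ?thesis using W U by (intro exI[of _ "W \<inter> V"]) auto
qed

text \<open>
  Stalks of additive subpresheaves are closed under finite sums.  The zero section is required only
  on some neighbourhood \<open>W\<^sub>0\<close> of the point, since \<^const>\<open>power_multiples\<close> is empty on large open sets.
\<close>
lemma germ_of_finsum:
  assumes P: "\<And>V W. is_open V \<Longrightarrow> is_open W \<Longrightarrow> W \<subseteq> V \<Longrightarrow> mres_of M V W ` P V \<subseteq> P W"
    and zero: "is_open W\<^sub>0" "x \<in> W\<^sub>0" "\<zero>\<^bsub>module_of M W\<^sub>0\<^esub> \<in> P W\<^sub>0"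
    and add: "\<And>W s t. is_open W \<Longrightarrow> s \<in> P W \<Longrightarrow> t \<in> P W \<Longrightarrow> s \<oplus>\<^bsub>module_of M W\<^esub> t \<in> P W"
    and V: "is_open V" "x \<in> V"
    and t: "\<And>i. i < k \<Longrightarrow> t i \<in> sections V" "\<And>i. i < k \<Longrightarrow> germ_of P x V (t i)"
  shows "germ_of P x V (\<Oplus>\<^bsub>module_of M V\<^esub>i\<in>{..<k::nat}. t i)"
  using t
proof (induction k)
  case 0
  interpret A: Module.module "ring_of X V" "module_of M V" by (rule module_sections[OF V(1)])
  have o: "is_open (W\<^sub>0 \<inter> V)" using zero V by auto
  have "mres_of M W\<^sub>0 (W\<^sub>0 \<inter> V) \<zero>\<^bsub>module_of M W\<^sub>0\<^esub> \<in> P (W\<^sub>0 \<inter> V)"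
    using P[of W\<^sub>0 "W\<^sub>0 \<inter> V"] zero o by auto
  then have "mres_of M V (W\<^sub>0 \<inter> V) \<zero>\<^bsub>module_of M V\<^esub> \<in> P (W\<^sub>0 \<inter> V)"
    using mres_zero[OF zero(1) o] mres_zero[OF V(1) o] by auto
  then show ?case using o zero V unfolding germ_in_def by (intro exI[of _ "W\<^sub>0 \<inter> V"]) auto
next
  case (Suc k)
  interpret A: Module.module "ring_of X V" "module_of M V" by (rule module_sections[OF V(1)])
  let ?S = "\<Oplus>\<^bsub>module_of M V\<^esub>i\<in>{..<k}. t i"
  have S: "?S \<in> sections V" using Suc.prems by (intro A.M.finsum_closed) auto
  have eq: "(\<Oplus>\<^bsub>module_of M V\<^esub>i\<in>{..<Suc k}. t i) = t k \<oplus>\<^bsub>module_of M V\<^esub> ?S"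
    unfolding lessThan_Suc using Suc.prems by (intro A.M.finsum_insert) auto
  have "germ_of P x V ?S" using Suc by simp
  from germ_of_restrict[OF P V(1) V(1) V(2) subset_refl S this]
  obtain W where W: "is_open W" "x \<in> W" "W \<subseteq> V"
      "\<And>W'. is_open W' \<Longrightarrow> W' \<subseteq> W \<Longrightarrow> mres_of M V W' ?S \<in> P W'"
    by blast
  from germ_of_restrict[OF P V(1) W(1) W(2) W(3), of "t k"] Suc.prems
  obtain W' where W': "is_open W'" "x \<in> W'" "W' \<subseteq> W" "mres_of M V W' (t k) \<in> P W'"
    by blast
  have "mres_of M V W' (t k \<oplus>\<^bsub>module_of M V\<^esub> ?S) \<in> P W'"
    using W W' V S Suc.prems by (subst mres_add) (auto intro!: add)
  then show ?case unfolding eq germ_in_def using W W' by blast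
qed

lemma is_submodule_sheaf_sections: "is_submodule_sheaf X M sections"
proof -
  have "submodule (sections U) (ring_of X U) (module_of M U)" if "is_open U" for U
    using module.carrier_is_submodule[OF module_sections[OF that]] .
  moreover have "mres_of M U V \<in> sections U \<rightarrow> sections V" if "is_open U" "is_open V" "V \<subseteq> U" for U V
    using mres_closed that by auto
  ultimately show ?thesis by (auto simp: is_submodule_sheaf_def generated_subsheaf_def)
qed

lemma submodule_sheafE:
  assumes "is_submodule_sheaf X M N"
  shows "is_open U \<Longrightarrow> N U \<subseteq> sections U"
    and "is_open U \<Longrightarrow> s \<in> N U \<Longrightarrow> t \<in> N U \<Longrightarrow> s \<oplus>\<^bsub>module_of M U\<^esub> t \<in> N U"
    and "is_open U \<Longrightarrow> a \<in> ring_sections U \<Longrightarrow> t \<in> N U \<Longrightarrow> a \<odot>\<^bsub>module_of M U\<^esub> t \<in> N U"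
    and "is_open U \<Longrightarrow> \<zero>\<^bsub>module_of M U\<^esub> \<in> N U"
    and "is_open U \<Longrightarrow> is_open V \<Longrightarrow> V \<subseteq> U \<Longrightarrow> s \<in> N U \<Longrightarrow> mres_of M U V s \<in> N V"
proof -
  have sub: "submodule (N U) (ring_of X U) (module_of M U)" if "is_open U" for U
    using assms that by (auto simp: is_submodule_sheaf_def)
  note E = module.submoduleE[OF module_sections sub]
  show "is_open U \<Longrightarrow> N U \<subseteq> sections U" using E(1) by blast
  show "is_open U \<Longrightarrow> s \<in> N U \<Longrightarrow> t \<in> N U \<Longrightarrow> s \<oplus>\<^bsub>module_of M U\<^esub> t \<in> N U" using E(5) by blast
  show "is_open U \<Longrightarrow> a \<in> ring_sections U \<Longrightarrow> t \<in> N U \<Longrightarrow> a \<odot>\<^bsub>module_of M U\<^esub> t \<in> N U"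
    using E(4) by blast
  show "is_open U \<Longrightarrow> \<zero>\<^bsub>module_of M U\<^esub> \<in> N U"
    using subgroup.one_closed[OF submodule.axioms(1)[OF sub]] by simp
  show "is_open U \<Longrightarrow> is_open V \<Longrightarrow> V \<subseteq> U \<Longrightarrow> s \<in> N U \<Longrightarrow> mres_of M U V s \<in> N V"
    using assms unfolding is_submodule_sheaf_def by blast
qed

lemma power_multiples_restrict:
  assumes N: "is_submodule_sheaf X M N" and U: "is_open U" "g \<in> ring_sections U"
    and VW: "is_open V" "is_open W" "W \<subseteq> V"
  shows "mres_of M V W ` power_multiples X M U g n N V \<subseteq> power_multiples X M U g n N W"
proof clarify
  fix s assume "s \<in> power_multiples X M U g n N V"
  then obtain y where y: "V \<subseteq> U" "y \<in> N V"
      "s = (res_of X U V g [^]\<^bsub>ring_of X V\<^esub> n) \<odot>\<^bsub>module_of M V\<^esub> y"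
    by (auto simp: power_multiples_def)
  interpret R: cring "ring_of X V" by (rule cring_sections[OF VW(1)])
  have g: "res_of X U V g \<in> ring_sections V" using res_closed U VW y by auto
  have yM: "y \<in> sections V" using submodule_sheafE(1)[OF N VW(1)] y by auto
  have "mres_of M V W s =
      (res_of X U W g [^]\<^bsub>ring_of X W\<^esub> n) \<odot>\<^bsub>module_of M W\<^esub> mres_of M V W y"
    unfolding y(3) using VW U g y yM by (simp add: mres_smult res_pow res_res)
  moreover have "mres_of M V W y \<in> N W" using submodule_sheafE(5)[OF N] VW y by auto
  ultimately show "mres_of M V W s \<in> power_multiples X M U g n N W"
    using VW y unfolding power_multiples_def by blast
qed

lemma power_multiples_add:
  assumes N: "is_submodule_sheaf X M N" and U: "is_open U" "g \<in> ring_sections U" and W: "is_open W"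
    and s: "s \<in> power_multiples X M U g n N W" and t: "t \<in> power_multiples X M U g n N W"
  shows "s \<oplus>\<^bsub>module_of M W\<^esub> t \<in> power_multiples X M U g n N W"
proof -
  interpret A: Module.module "ring_of X W" "module_of M W" by (rule module_sections[OF W])
  let ?h = "res_of X U W g [^]\<^bsub>ring_of X W\<^esub> n"
  obtain y z where y: "W \<subseteq> U" "y \<in> N W" "s = ?h \<odot>\<^bsub>module_of M W\<^esub> y"
    and z: "z \<in> N W" "t = ?h \<odot>\<^bsub>module_of M W\<^esub> z"
    using s t by (auto simp: power_multiples_def)
  have h: "?h \<in> ring_sections W" using res_closed U W y by auto
  have "s \<oplus>\<^bsub>module_of M W\<^esub> t = ?h \<odot>\<^bsub>module_of M W\<^esub> (y \<oplus>\<^bsub>module_of M W\<^esub> z)"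
    using y z h submodule_sheafE(1)[OF N W] by (subst A.smult_r_distr) auto
  then show ?thesis
    using submodule_sheafE(2)[OF N W y(2) z(1)] y(1) unfolding power_multiples_def by blast
qed

text \<open>
  On a common neighbourhood, \<open>(g\<^sup>m r) (g\<^sup>n z) = g\<^sup>m\<^sup>+\<^sup>n (r z)\<close>.
\<close>
lemma germ_of_smult_power_multiples:
  assumes N: "is_submodule_sheaf X M N" and U: "is_open U" "g \<in> ring_sections U"
    and V: "is_open V" "x \<in> V" "c \<in> ring_sections V" "y \<in> sections V"
    and c: "ring_germ_of (power_multiples X (structure_module X) U g m ring_sections) x V c"
    and y: "germ_of (power_multiples X M U g n N) x V y"
  shows "germ_of (power_multiples X M U g (m + n) N) x V (c \<odot>\<^bsub>module_of M V\<^esub> y)"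
proof -
  obtain W1 r where W1: "is_open W1" "x \<in> W1" "W1 \<subseteq> V" "W1 \<subseteq> U" and r: "r \<in> ring_sections W1"
    and cr: "res_of X V W1 c = (res_of X U W1 g [^]\<^bsub>ring_of X W1\<^esub> m) \<otimes>\<^bsub>ring_of X W1\<^esub> r"
    using c by (auto simp: germ_in_def power_multiples_def structure_module_def self_module_def)
  from germ_of_restrict[OF power_multiples_restrict[OF N U] V(1) W1(1,2,3) V(4) y]
  obtain W where W: "is_open W" "x \<in> W" "W \<subseteq> W1"
      "mres_of M V W y \<in> power_multiples X M U g n N W" by blast
  then obtain z where z: "z \<in> N W"
      "mres_of M V W y = (res_of X U W g [^]\<^bsub>ring_of X W\<^esub> n) \<odot>\<^bsub>module_of M W\<^esub> z"
    by (auto simp: power_multiples_def)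
  interpret A: Module.module "ring_of X W" "module_of M W" by (rule module_sections[OF W(1)])
  interpret R1: cring "ring_of X W1" by (rule cring_sections[OF W1(1)])
  let ?g = "res_of X U W g" and ?r = "res_of X W1 W r"
  have g: "?g \<in> ring_sections W" and r': "?r \<in> ring_sections W"
    using res_closed U W W1 r by auto
  have g1: "res_of X U W1 g \<in> ring_sections W1" using res_closed U W1 by auto
  have zM: "z \<in> sections W" using submodule_sheafE(1)[OF N W(1)] z by auto
  have "res_of X V W c = res_of X W1 W (res_of X V W1 c)"
    using res_res[of V W1 W c] V W W1 by auto
  also have "\<dots> = (?g [^]\<^bsub>ring_of X W\<^esub> m) \<otimes>\<^bsub>ring_of X W\<^esub> ?r"
    unfolding cr using W W1 U r g1 by (simp add: res_mult res_pow res_res)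
  finally have c': "res_of X V W c = (?g [^]\<^bsub>ring_of X W\<^esub> m) \<otimes>\<^bsub>ring_of X W\<^esub> ?r" .
  have "mres_of M V W (c \<odot>\<^bsub>module_of M V\<^esub> y) =
      ((?g [^]\<^bsub>ring_of X W\<^esub> m) \<otimes>\<^bsub>ring_of X W\<^esub> ?r) \<odot>\<^bsub>module_of M W\<^esub>
        ((?g [^]\<^bsub>ring_of X W\<^esub> n) \<odot>\<^bsub>module_of M W\<^esub> z)"
    using V W W1 by (subst mres_smult) (auto simp: c' z(2))
  also have "\<dots> = (((?g [^]\<^bsub>ring_of X W\<^esub> m) \<otimes>\<^bsub>ring_of X W\<^esub> ?r) \<otimes>\<^bsub>ring_of X W\<^esub>
        (?g [^]\<^bsub>ring_of X W\<^esub> n)) \<odot>\<^bsub>module_of M W\<^esub> z"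
    using g r' zM by (subst A.smult_assoc1) auto
  also have "((?g [^]\<^bsub>ring_of X W\<^esub> m) \<otimes>\<^bsub>ring_of X W\<^esub> ?r) \<otimes>\<^bsub>ring_of X W\<^esub> (?g [^]\<^bsub>ring_of X W\<^esub> n)
      = (?g [^]\<^bsub>ring_of X W\<^esub> (m + n)) \<otimes>\<^bsub>ring_of X W\<^esub> ?r"
    using g r' by (simp add: A.R.nat_pow_mult[symmetric] A.R.m_ac)
  also have "\<dots> \<odot>\<^bsub>module_of M W\<^esub> z =
      (?g [^]\<^bsub>ring_of X W\<^esub> (m + n)) \<odot>\<^bsub>module_of M W\<^esub> (?r \<odot>\<^bsub>module_of M W\<^esub> z)"
    using g r' zM by (subst A.smult_assoc1) auto
  finally have "mres_of M V W (c \<odot>\<^bsub>module_of M V\<^esub> y) \<in> power_multiples X M U g (m + n) N W"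
    using submodule_sheafE(3)[OF N W(1) r' z(1)] W(3) W1(4) unfolding power_multiples_def by blast
  then show ?thesis using W W1 unfolding germ_in_def by blast
qed

text \<open>
  If the germs of \<^term>\<open>J\<close> at \<^term>\<open>x\<close> are multiples of \<open>g\<^sup>m\<close> and those of \<^term>\<open>K\<close> lie in
  \<open>g\<^sup>n N\<close>, then those of \<open>J K\<close> lie in \<open>g\<^sup>m\<^sup>+\<^sup>n N\<close>.  With \<^term>\<open>M\<close> the structure sheaf this is the
  induction step for powers of an ideal; with \<^term>\<open>n = 0\<close> and \<^term>\<open>K = N\<close> it describes the
  product of such a power with \<^term>\<open>N\<close>.
\<close>
lemma germ_of_ideal_mult:
  assumes N: "is_submodule_sheaf X M N" and U: "is_open U" "g \<in> ring_sections U"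
    and V: "is_open V" "x \<in> V" "x \<in> U"
    and J: "\<And>W. is_open W \<Longrightarrow> J W \<subseteq> ring_sections W"
      "\<And>W a. is_open W \<Longrightarrow> x \<in> W \<Longrightarrow> a \<in> J W \<Longrightarrow>
        ring_germ_of (power_multiples X (structure_module X) U g m ring_sections) x W a"
    and K: "\<And>W. is_open W \<Longrightarrow> K W \<subseteq> sections W"
      "\<And>W y. is_open W \<Longrightarrow> x \<in> W \<Longrightarrow> y \<in> K W \<Longrightarrow> germ_of (power_multiples X M U g n N) x W y"
    and s: "s \<in> ideal_mult X M J K V"
  shows "germ_of (power_multiples X M U g (m + n) N) x V s"
proof -
  let ?P = "power_multiples X M U g (m + n) N"
  obtain W and k :: nat and a y where W: "is_open W" "x \<in> W" "W \<subseteq> V"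
    and ay: "a \<in> {..<k} \<rightarrow> J W" "y \<in> {..<k} \<rightarrow> K W"
    and sW: "mres_of M V W s = (\<Oplus>\<^bsub>module_of M W\<^esub>i\<in>{..<k}. a i \<odot>\<^bsub>module_of M W\<^esub> y i)"
    and sV: "s \<in> sections V"
    using s V unfolding ideal_mult_def generated_subsheaf_def by blast
  interpret A: Module.module "ring_of X W" "module_of M W" by (rule module_sections[OF W(1)])
  interpret B: Module.module "ring_of X U" "module_of M U" by (rule module_sections[OF U(1)])
  have aW: "a i \<in> ring_sections W" and yW: "y i \<in> sections W" if "i < k" for i
    using ay J(1)[OF W(1)] K(1)[OF W(1)] that by auto
  have "\<zero>\<^bsub>module_of M U\<^esub> = (res_of X U U g [^]\<^bsub>ring_of X U\<^esub> (m + n)) \<odot>\<^bsub>module_of M U\<^esub> \<zero>\<^bsub>module_of M U\<^esub>"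
    using U by (simp add: res_id)
  then have z: "\<zero>\<^bsub>module_of M U\<^esub> \<in> ?P U"
    using submodule_sheafE(4)[OF N U(1)] unfolding power_multiples_def by blast
  have "germ_of ?P x W (\<Oplus>\<^bsub>module_of M W\<^esub>i\<in>{..<k}. a i \<odot>\<^bsub>module_of M W\<^esub> y i)"
  proof (rule germ_of_finsum[OF power_multiples_restrict[OF N U] U(1) V(3) z
        power_multiples_add[OF N U] W(1,2)])
    fix i assume i: "i < k"
    then show "a i \<odot>\<^bsub>module_of M W\<^esub> y i \<in> sections W" using aW yW by auto
    have "a i \<in> J W" "y i \<in> K W" using ay i by auto
    then show "germ_of ?P x W (a i \<odot>\<^bsub>module_of M W\<^esub> y i)"
      using germ_of_smult_power_multiples[OF N U W(1,2) aW[OF i] yW[OF i]] J(2) K(2) W by blast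
  qed
  then obtain W' where W': "is_open W'" "x \<in> W'" "W' \<subseteq> W" "mres_of M W W' (mres_of M V W s) \<in> ?P W'"
    unfolding sW germ_in_def by blast
  then show ?thesis
    using mres_mres[OF V(1) W(1) W'(1) W(3) W'(3) sV] W unfolding germ_in_def by auto
qed

lemma smult_in_ideal_mult:
  assumes W: "is_open W" and a: "a \<in> J W" "a \<in> ring_sections W" and y: "y \<in> K W" "y \<in> sections W"
  shows "a \<odot>\<^bsub>module_of M W\<^esub> y \<in> ideal_mult X M J K W"
proof -
  interpret A: Module.module "ring_of X W" "module_of M W" by (rule module_sections[OF W])
  let ?P = "\<lambda>U. {\<Oplus>\<^bsub>module_of M U\<^esub>i\<in>{..<k}. a i \<odot>\<^bsub>module_of M U\<^esub> y i | (k :: nat) a y.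
               a \<in> {..<k} \<rightarrow> J U \<and> y \<in> {..<k} \<rightarrow> K U}"
  have ay: "a \<odot>\<^bsub>module_of M W\<^esub> y \<in> sections W" using a y by auto
  have "a \<odot>\<^bsub>module_of M W\<^esub> y = (\<Oplus>\<^bsub>module_of M W\<^esub>i\<in>{..<Suc 0}. a \<odot>\<^bsub>module_of M W\<^esub> y)"
    using ay by (simp add: lessThan_Suc)
  moreover have "(\<lambda>_. a) \<in> {..<Suc 0} \<rightarrow> J W" "(\<lambda>_. y) \<in> {..<Suc 0} \<rightarrow> K W" using a y by auto
  ultimately have "a \<odot>\<^bsub>module_of M W\<^esub> y \<in> ?P W"
    by (intro CollectI exI[of _ "Suc 0"] exI[of _ "\<lambda>_. a"] exI[of _ "\<lambda>_. y"]) simp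
  then have "mres_of M W W (a \<odot>\<^bsub>module_of M W\<^esub> y) \<in> ?P W" using mres_id[OF W ay] by simp
  then show ?thesis using W ay unfolding ideal_mult_def generated_subsheaf_def by blast
qed

end

section \<open>Powers of a locally principal ideal\<close>

lemma sheaf_of_modules_structure_module:
  assumes "is_ringed_space X"
  shows "sheaf_of_modules X (structure_module X)"
proof
  show "is_ringed_space X" by fact
  have "Module.module R (self_module R)" if "cring R" for R :: "'b ring"
  proof -
    interpret cring R by fact
    have "abelian_group (self_module R)"
      by (rule abelian_groupI) (auto simp: self_module_def a_ac intro: l_neg)
    then show ?thesis
      by (intro moduleI) (auto simp: self_module_def is_cring m_assoc l_distr r_distr)
  qed
  then show "is_module_sheaf X (structure_module X)"
    using assms unfolding is_ringed_space_def is_module_sheaf_def structure_module_def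
    by (auto simp: self_module_def ring_hom_def)
qed

definition generates_on ::
    "('a, 'b) ringed_space \<Rightarrow> ('a set \<Rightarrow> 'b set) \<Rightarrow> 'a set \<Rightarrow> 'b \<Rightarrow> bool" where
  "generates_on X I U g \<longleftrightarrow> openin (space_of X) U \<and> g \<in> I U \<and>
     (\<forall>V. openin (space_of X) V \<and> V \<subseteq> U \<longrightarrow>
        I V = generated_subsheaf (space_of X) (\<lambda>W. carrier (ring_of X W)) (res_of X)
                (\<lambda>W. PIdl\<^bsub>ring_of X W\<^esub> (res_of X U W g)) V)"

lemma locally_principal_generator:
  assumes "locally_principal X I" "x \<in> topspace (space_of X)"
  obtains U g where "x \<in> U" "generates_on X I U g"
proof -
  from bspec[OF assms(1)[unfolded locally_principal_def] assms(2)] show thesis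
    by (elim exE conjE bexE) (rule that, assumption, unfold generates_on_def, intro conjI, assumption+)
qed

locale principal_ideal_chart =
  fixes X :: "('a, 'b) ringed_space" and I :: "'a set \<Rightarrow> 'b set" and U :: "'a set" and g :: 'b
  assumes ringed: "is_ringed_space X"
    and ideal: "is_ideal_sheaf X I"
    and gen: "generates_on X I U g"
begin

sublocale O: sheaf_of_modules X "structure_module X"
  by (rule sheaf_of_modules_structure_module[OF ringed])

lemmas ideal_sub = ideal[unfolded is_ideal_sheaf_def]

lemma U_open: "openin (space_of X) U"
  using gen by (simp add: generates_on_def)

lemma carrier_structure [simp]: "carrier (module_of (structure_module X) W) = carrier (ring_of X W)"
  by (simp add: structure_module_def self_module_def)

lemma mres_structure [simp]: "mres_of (structure_module X) = res_of X"
  by (simp add: structure_module_def)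

lemma smult_structure [simp]: "smult (module_of (structure_module X) W) = mult (ring_of X W)"
  by (simp add: structure_module_def self_module_def)

lemma ideal_carrier: "openin (space_of X) W \<Longrightarrow> I W \<subseteq> carrier (ring_of X W)"
  using O.submodule_sheafE(1)[OF ideal_sub] by simp

lemma g_closed: "g \<in> carrier (ring_of X U)"
  using ideal_carrier[OF U_open] gen by (auto simp: generates_on_def)

lemma structure_sub: "is_submodule_sheaf X (structure_module X) (\<lambda>W. carrier (ring_of X W))"
  using O.is_submodule_sheaf_sections by simp

abbreviation "ring_multiples n \<equiv>
  power_multiples X (structure_module X) U g n (\<lambda>W. carrier (ring_of X W))"

lemma ideal_germ:
  assumes W: "openin (space_of X) W" "x \<in> W" "x \<in> U" and a: "a \<in> I W"
  shows "O.ring_germ_of (ring_multiples 1) x W a"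
proof -
  have aW: "a \<in> carrier (ring_of X W)" using ideal_carrier W a by auto
  let ?V = "W \<inter> U"
  have V: "openin (space_of X) ?V" using W U_open by auto
  have "res_of X W ?V a \<in> I ?V" using O.submodule_sheafE(5)[OF ideal_sub W(1) V] a by auto
  then have "res_of X W ?V a \<in> generated_subsheaf (space_of X) (\<lambda>W. carrier (ring_of X W)) (res_of X)
                (\<lambda>W. PIdl\<^bsub>ring_of X W\<^esub> (res_of X U W g)) ?V"
    using gen V by (auto simp: generates_on_def)
  then obtain W' where W': "openin (space_of X) W'" "x \<in> W'" "W' \<subseteq> ?V"
      "res_of X ?V W' (res_of X W ?V a) \<in> PIdl\<^bsub>ring_of X W'\<^esub> (res_of X U W' g)"
    using W unfolding generated_subsheaf_def by blast
  have eq: "res_of X ?V W' (res_of X W ?V a) = res_of X W W' a"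
    using O.res_res[OF W(1) V W'(1)] W' aW by auto
  obtain r where r: "r \<in> carrier (ring_of X W')"
      "res_of X W W' a = r \<otimes>\<^bsub>ring_of X W'\<^esub> res_of X U W' g"
    using W'(4) unfolding eq cgenideal_def by blast
  interpret R: cring "ring_of X W'" by (rule O.cring_sections[OF W'(1)])
  have g': "res_of X U W' g \<in> carrier (ring_of X W')"
    using O.res_closed[OF U_open W'(1) _ g_closed] W' by auto
  have "res_of X W W' a = (res_of X U W' g [^]\<^bsub>ring_of X W'\<^esub> (1::nat)) \<otimes>\<^bsub>ring_of X W'\<^esub> r"
    using r g' by (simp add: R.m_comm)
  then have "res_of X W W' a \<in> ring_multiples 1 W'"
    using r W' unfolding power_multiples_def by auto
  then show ?thesis using W' unfolding germ_in_def by blast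
qed

lemma ideal_power_carrier:
  "openin (space_of X) W \<Longrightarrow> ideal_power X I n W \<subseteq> carrier (ring_of X W)"
  by (cases n) (auto simp: ideal_mult_def generated_subsheaf_def)

text \<open>
  Germs of the ideal are multiples of \<open>g\<close> because \<open>g\<close> generates it, and multiplying germs adds
  the exponents of \<open>g\<close>.
\<close>
lemma ideal_power_germ:
  assumes "openin (space_of X) W" "x \<in> W" "x \<in> U" "a \<in> ideal_power X I n W"
  shows "O.ring_germ_of (ring_multiples n) x W a"
  using assms
proof (induction n arbitrary: W a)
  case 0
  let ?V = "W \<inter> U"
  have V: "openin (space_of X) ?V" using 0 U_open by auto
  interpret R: cring "ring_of X ?V" by (rule O.cring_sections[OF V])
  have r: "res_of X W ?V a \<in> carrier (ring_of X ?V)"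
    using O.res_closed[OF 0(1) V] 0 by auto
  then have "res_of X W ?V a =
      (res_of X U ?V g [^]\<^bsub>ring_of X ?V\<^esub> (0::nat)) \<otimes>\<^bsub>ring_of X ?V\<^esub> res_of X W ?V a"
    by simp
  then have "res_of X W ?V a \<in> ring_multiples 0 ?V"
    using r unfolding power_multiples_def smult_structure by blast
  then show ?case using V 0 unfolding germ_in_def by (intro exI[of _ ?V]) auto
next
  case (Suc n)
  have "O.germ_of (ring_multiples (1 + n)) x W a"
  proof (rule O.germ_of_ideal_mult[OF structure_sub U_open g_closed, where J=I and K="ideal_power X I n"])
    show "a \<in> ideal_mult X (structure_module X) I (ideal_power X I n) W" using Suc.prems by simp
  qed (use Suc ideal_carrier ideal_germ ideal_power_carrier in auto)
  then show ?case by simp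
qed

lemma power_in_ideal_power:
  assumes W: "openin (space_of X) W" "W \<subseteq> U"
  shows "res_of X U W g [^]\<^bsub>ring_of X W\<^esub> n \<in> ideal_power X I n W"
proof (induction n)
  case 0
  interpret R: cring "ring_of X W" by (rule O.cring_sections[OF W(1)])
  show ?case by simp
next
  case (Suc n)
  interpret R: cring "ring_of X W" by (rule O.cring_sections[OF W(1)])
  have g: "res_of X U W g \<in> I W"
    using O.submodule_sheafE(5)[OF ideal_sub U_open W] gen by (auto simp: generates_on_def)
  have gW: "res_of X U W g \<in> carrier (ring_of X W)" using g ideal_carrier[OF W(1)] by auto
  show ?case
    using O.smult_in_ideal_mult[OF W(1), of "res_of X U W g" I
        "res_of X U W g [^]\<^bsub>ring_of X W\<^esub> n" "ideal_power X I n"] g gW Suc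
    by (simp add: R.m_comm)
qed

end

section \<open>The Cartier operator and the periodicity of jumps\<close>

locale cartier_module_with_ideal = sheaf_of_modules X M
  for X :: "('a, 'b) ringed_space" and M :: "('a, 'b, 'c) module_sheaf" +
  fixes q :: nat and C :: "'a set \<Rightarrow> 'c \<Rightarrow> 'c" and I :: "'a set \<Rightarrow> 'b set" and N :: "'a set \<Rightarrow> 'c set"
  assumes cartier: "cartier_module q X M C"
    and ideal: "is_ideal_sheaf X I"
    and principal: "locally_principal X I"
    and N_sub: "is_submodule_sheaf X M N"
begin

lemma C_closed: "is_open U \<Longrightarrow> s \<in> sections U \<Longrightarrow> C U s \<in> sections U"
  using cartier[unfolded cartier_module_def, THEN conjunct2, THEN conjunct1] by (simp add: Pi_iff)

lemma C_semilinear: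
  "is_open U \<Longrightarrow> a \<in> ring_sections U \<Longrightarrow> s \<in> sections U \<Longrightarrow>
   C U ((a [^]\<^bsub>ring_of X U\<^esub> q) \<odot>\<^bsub>module_of M U\<^esub> s) = a \<odot>\<^bsub>module_of M U\<^esub> C U s"
  using cartier[unfolded cartier_module_def, THEN conjunct2, THEN conjunct1] by simp

lemma mres_C:
  "is_open U \<Longrightarrow> is_open V \<Longrightarrow> V \<subseteq> U \<Longrightarrow> s \<in> sections U \<Longrightarrow>
   mres_of M U V (C U s) = C V (mres_of M U V s)"
  using cartier[unfolded cartier_module_def, THEN conjunct2, THEN conjunct2] by simp

lemma C_pow_closed: "is_open U \<Longrightarrow> s \<in> sections U \<Longrightarrow> (C U ^^ m) s \<in> sections U"
  by (induction m) (simp_all add: C_closed)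

lemma mres_C_pow:
  assumes "is_open U" "is_open V" "V \<subseteq> U" "s \<in> sections U"
  shows "mres_of M U V ((C U ^^ m) s) = (C V ^^ m) (mres_of M U V s)"
proof (induction m)
  case (Suc m)
  then show ?case using mres_C[OF assms(1-3) C_pow_closed[OF assms(1,4)]] by simp
qed simp

text \<open>
  Each application of the operator takes one \<open>q\<close>-th root of the scalar, so \<open>C\<^sup>m\<close> takes \<open>q\<^sup>m\<close>-th
  roots.
\<close>
lemma C_pow_smult:
  assumes U: "is_open U" "a \<in> ring_sections U" "s \<in> sections U"
  shows "(C U ^^ m) ((a [^]\<^bsub>ring_of X U\<^esub> (q ^ m)) \<odot>\<^bsub>module_of M U\<^esub> s) = a \<odot>\<^bsub>module_of M U\<^esub> (C U ^^ m) s"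
proof -
  interpret A: Module.module "ring_of X U" "module_of M U" by (rule module_sections[OF U(1)])
  show ?thesis using U(3)
  proof (induction m arbitrary: s)
    case 0
    then show ?case using U(2) by simp
  next
    case (Suc m)
    let ?b = "a [^]\<^bsub>ring_of X U\<^esub> (q ^ m)"
    have "a [^]\<^bsub>ring_of X U\<^esub> (q ^ Suc m) = ?b [^]\<^bsub>ring_of X U\<^esub> q"
      using A.R.nat_pow_pow[OF U(2)] by (simp add: mult.commute)
    then have "C U ((a [^]\<^bsub>ring_of X U\<^esub> (q ^ Suc m)) \<odot>\<^bsub>module_of M U\<^esub> s) =
        ?b \<odot>\<^bsub>module_of M U\<^esub> C U s"
      using C_semilinear[OF U(1) _ Suc.prems] U(2) by (simp only: A.R.nat_pow_closed)
    moreover have "(C U ^^ m) (?b \<odot>\<^bsub>module_of M U\<^esub> C U s) =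
        a \<odot>\<^bsub>module_of M U\<^esub> (C U ^^ m) (C U s)"
      by (rule Suc.IH[OF C_closed[OF U(1) Suc.prems]])
    ultimately show ?case unfolding funpow_Suc_right comp_apply by (simp only:)
  qed
qed

abbreviation "power_image m n \<equiv> cartier_image X M C m (ideal_mult X M (ideal_power X I n) N)"

lemma ideal_mult_closed: "ideal_mult X M J K U \<subseteq> sections U"
  by (auto simp: ideal_mult_def generated_subsheaf_def)

lemma C_pow_in_power_image:
  assumes "is_open U" "y \<in> ideal_mult X M (ideal_power X I n) N U"
  shows "(C U ^^ m) y \<in> power_image m n U"
proof -
  have "(C U ^^ m) y \<in> sections U" using C_pow_closed assms ideal_mult_closed by blast
  then show ?thesis
    using assms mres_id[of U "(C U ^^ m) y"] unfolding cartier_image_def generated_subsheaf_def by auto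
qed

lemma power_multiple_in_ideal_mult:
  assumes gen: "generates_on X I U g" and W: "is_open W" "W \<subseteq> U" and y: "y \<in> N W"
  shows "(res_of X U W g [^]\<^bsub>ring_of X W\<^esub> n) \<odot>\<^bsub>module_of M W\<^esub> y \<in> ideal_mult X M (ideal_power X I n) N W"
proof -
  interpret P: principal_ideal_chart X I U g
    using ringed ideal gen by unfold_locales
  show ?thesis
  proof (rule smult_in_ideal_mult[OF W(1)])
    show g: "res_of X U W g [^]\<^bsub>ring_of X W\<^esub> n \<in> ideal_power X I n W"
      by (rule P.power_in_ideal_power[OF W])
    show "res_of X U W g [^]\<^bsub>ring_of X W\<^esub> n \<in> ring_sections W"
      using g P.ideal_power_carrier[OF W(1)] by blast
    show "y \<in> N W" by (rule y)
    then show "y \<in> sections W" using submodule_sheafE(1)[OF N_sub W(1)] by blast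
  qed
qed

text \<open>
  The neighbourhood is shrunk twice: first until the section of the image sheaf is the image of a
  section of \<open>I\<^sup>n N\<close>, then until that section is a multiple of \<open>g\<^sup>n\<close>.  The second step is
  compatible with the first because \<^term>\<open>C\<close> commutes with restriction.
\<close>
lemma power_image_germ:
  assumes gen: "generates_on X I U g" and V: "is_open V" "x \<in> V" "x \<in> U"
    and s: "s \<in> power_image m n V"
  obtains W y where "is_open W" "x \<in> W" "W \<subseteq> V" "W \<subseteq> U" "y \<in> N W"
    "mres_of M V W s = (C W ^^ m) ((res_of X U W g [^]\<^bsub>ring_of X W\<^esub> n) \<odot>\<^bsub>module_of M W\<^esub> y)"
proof -
  interpret P: principal_ideal_chart X I U g
    using ringed ideal gen by unfold_locales
  obtain W y where W: "is_open W" "x \<in> W" "W \<subseteq> V" and sV: "s \<in> sections V"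
    and y: "y \<in> ideal_mult X M (ideal_power X I n) N W" "mres_of M V W s = (C W ^^ m) y"
    using s V unfolding cartier_image_def generated_subsheaf_def by blast
  have N0: "germ_of (power_multiples X M U g 0 N) x W' z" if "is_open W'" "x \<in> W'" "z \<in> N W'" for W' z
  proof -
    let ?V = "W' \<inter> U"
    have o: "is_open ?V" using that P.U_open by auto
    interpret A: Module.module "ring_of X ?V" "module_of M ?V" by (rule module_sections[OF o])
    have z: "mres_of M W' ?V z \<in> N ?V" using submodule_sheafE(5)[OF N_sub that(1) o] that by auto
    then have "mres_of M W' ?V z =
       (res_of X U ?V g [^]\<^bsub>ring_of X ?V\<^esub> (0::nat)) \<odot>\<^bsub>module_of M ?V\<^esub> mres_of M W' ?V z"
      using submodule_sheafE(1)[OF N_sub o] by auto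
    then have "mres_of M W' ?V z \<in> power_multiples X M U g 0 N ?V"
      using z unfolding power_multiples_def by blast
    then show ?thesis using that V o unfolding germ_in_def by (intro exI[of _ ?V]) auto
  qed
  have "germ_of (power_multiples X M U g (n + 0) N) x W y"
  proof (rule germ_of_ideal_mult[OF N_sub P.U_open P.g_closed W(1,2) V(3)])
    show "ideal_power X I n W' \<subseteq> ring_sections W'" if "is_open W'" for W'
      by (rule P.ideal_power_carrier[OF that])
    show "ring_germ_of (P.ring_multiples n) x W' a"
      if "is_open W'" "x \<in> W'" "a \<in> ideal_power X I n W'" for W' a
      by (rule P.ideal_power_germ[OF that(1,2) V(3) that(3)])
    show "N W' \<subseteq> sections W'" if "is_open W'" for W'
      by (rule submodule_sheafE(1)[OF N_sub that])
  qed (use N0 y(1) in blast)+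
  then obtain W' z where W': "is_open W'" "x \<in> W'" "W' \<subseteq> W" "W' \<subseteq> U" and z: "z \<in> N W'"
      "mres_of M W W' y = (res_of X U W' g [^]\<^bsub>ring_of X W'\<^esub> n) \<odot>\<^bsub>module_of M W'\<^esub> z"
    unfolding germ_in_def power_multiples_def by auto
  have yW: "y \<in> sections W" using y ideal_mult_closed by blast
  have "mres_of M V W' s = mres_of M W W' ((C W ^^ m) y)"
    using mres_mres[OF V(1) W(1) W'(1) W(3) W'(3) sV] y by simp
  also have "\<dots> = (C W' ^^ m) ((res_of X U W' g [^]\<^bsub>ring_of X W'\<^esub> n) \<odot>\<^bsub>module_of M W'\<^esub> z)"
    using mres_C_pow[OF W(1) W'(1,3) yW] z by simp
  finally show thesis by (rule that[OF W'(1,2) subset_trans[OF W'(3) W(3)] W'(4) z(1)])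
qed

text \<open>
  Near a point write a section of \<open>C\<^sup>m (I\<^sup>k\<^sup>+\<^sup>Q N)\<close> as \<open>C\<^sup>m (g\<^sup>k\<^sup>+\<^sup>Q y) = g t\<close> with
  \<open>t = C\<^sup>m (g\<^sup>k y)\<close>.  By hypothesis \<open>t\<close> is locally \<open>C\<^sup>m (g\<^sup>l z)\<close>, and so the section is locally
  \<open>g C\<^sup>m (g\<^sup>l z) = C\<^sup>m (g\<^sup>l\<^sup>+\<^sup>Q z)\<close>.  Inclusion, rather than equality, is what is transported, with
  \<^term>\<open>k\<close> and \<^term>\<open>l\<close> unrelated, so that one argument gives both halves of an equality.
\<close>
lemma power_image_shift:
  assumes H: "\<And>V. is_open V \<Longrightarrow> power_image m k V \<subseteq> power_image m l V"
    and U: "is_open U"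
  shows "power_image m (k + q ^ m) U \<subseteq> power_image m (l + q ^ m) U"
proof
  fix s assume s: "s \<in> power_image m (k + q ^ m) U"
  then have sU: "s \<in> sections U" by (auto simp: cartier_image_def generated_subsheaf_def)
  have "germ_of (\<lambda>W. (C W ^^ m) ` ideal_mult X M (ideal_power X I (l + q ^ m)) N W) x U s" if x: "x \<in> U" for x
  proof -
    have "x \<in> topspace (space_of X)" using x openin_subset[OF U] by blast
    from locally_principal_generator[OF principal this]
    obtain U0 g where U0: "x \<in> U0" and gen: "generates_on X I U0 g" .
    interpret P: principal_ideal_chart X I U0 g
      using ringed ideal gen by unfold_locales
    \<comment> \<open>One factor of \<open>g\<close> outside the operator is worth \<open>q\<^sup>m\<close> factors inside.\<close>
    have shift: "(C W ^^ m) ((res_of X U0 W g [^]\<^bsub>ring_of X W\<^esub> (n + q ^ m)) \<odot>\<^bsub>module_of M W\<^esub> y) =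
        res_of X U0 W g \<odot>\<^bsub>module_of M W\<^esub>
          (C W ^^ m) ((res_of X U0 W g [^]\<^bsub>ring_of X W\<^esub> n) \<odot>\<^bsub>module_of M W\<^esub> y)"
      if W: "is_open W" "W \<subseteq> U0" and y: "y \<in> N W" for W y n
    proof -
      interpret A: Module.module "ring_of X W" "module_of M W" by (rule module_sections[OF W(1)])
      have g: "res_of X U0 W g \<in> ring_sections W" by (rule res_closed[OF P.U_open W P.g_closed])
      have yM: "y \<in> sections W" using submodule_sheafE(1)[OF N_sub W(1)] y by auto
      have "(res_of X U0 W g [^]\<^bsub>ring_of X W\<^esub> (n + q ^ m)) \<odot>\<^bsub>module_of M W\<^esub> y =
        (res_of X U0 W g [^]\<^bsub>ring_of X W\<^esub> (q ^ m)) \<odot>\<^bsub>module_of M W\<^esub>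
          ((res_of X U0 W g [^]\<^bsub>ring_of X W\<^esub> n) \<odot>\<^bsub>module_of M W\<^esub> y)"
        using g yM by (simp add: A.smult_assoc1[symmetric] A.R.nat_pow_mult add.commute)
      then show ?thesis using C_pow_smult[OF W(1) g] g yM by simp
    qed
    obtain W y where W: "is_open W" "x \<in> W" "W \<subseteq> U" "W \<subseteq> U0" and y: "y \<in> N W"
      and sW: "mres_of M U W s =
        (C W ^^ m) ((res_of X U0 W g [^]\<^bsub>ring_of X W\<^esub> (k + q ^ m)) \<odot>\<^bsub>module_of M W\<^esub> y)"
      using power_image_germ[OF gen U x U0 s] by blast
    define t where "t = (C W ^^ m) ((res_of X U0 W g [^]\<^bsub>ring_of X W\<^esub> k) \<odot>\<^bsub>module_of M W\<^esub> y)"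
    have "t \<in> power_image m l W"
      using C_pow_in_power_image[OF W(1) power_multiple_in_ideal_mult[OF gen W(1,4) y]] H[OF W(1)]
      unfolding t_def by blast
    then have tM: "t \<in> sections W" by (auto simp: cartier_image_def generated_subsheaf_def)
    obtain W' z where W': "is_open W'" "x \<in> W'" "W' \<subseteq> W" "W' \<subseteq> U0" and z: "z \<in> N W'"
      and tW': "mres_of M W W' t =
        (C W' ^^ m) ((res_of X U0 W' g [^]\<^bsub>ring_of X W'\<^esub> l) \<odot>\<^bsub>module_of M W'\<^esub> z)"
      using power_image_germ[OF gen W(1,2) U0 \<open>t \<in> power_image m l W\<close>] by blast
    have g: "res_of X U0 W g \<in> ring_sections W" by (rule res_closed[OF P.U_open W(1,4) P.g_closed])
    have "mres_of M U W' s = mres_of M W W' (mres_of M U W s)"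
      using mres_mres[OF U W(1) W'(1) W(3) W'(3) sU] by simp
    also have "\<dots> = mres_of M W W' (res_of X U0 W g \<odot>\<^bsub>module_of M W\<^esub> t)"
      unfolding sW t_def shift[OF W(1,4) y] ..
    also have "\<dots> = res_of X U0 W' g \<odot>\<^bsub>module_of M W'\<^esub> mres_of M W W' t"
      using mres_smult[OF W(1) W'(1,3) g tM] res_res[OF P.U_open W(1) W'(1) W(4) W'(3) P.g_closed]
      by simp
    also have "\<dots> = (C W' ^^ m)
        ((res_of X U0 W' g [^]\<^bsub>ring_of X W'\<^esub> (l + q ^ m)) \<odot>\<^bsub>module_of M W'\<^esub> z)"
      unfolding tW' shift[OF W'(1,4) z] ..
    finally have "mres_of M U W' s \<in> (C W' ^^ m) ` ideal_mult X M (ideal_power X I (l + q ^ m)) N W'"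
      using power_multiple_in_ideal_mult[OF gen W'(1,4) z] by blast
    then show ?thesis using W W' unfolding germ_in_def by blast
  qed
  then show "s \<in> power_image m (l + q ^ m) U"
    using sU unfolding cartier_image_def generated_subsheaf_iff by blast
qed

lemma nu_shift:
  assumes "k + q ^ m \<in> nu X M C I N m"
  shows "k \<in> nu X M C I N m"
proof (rule ccontr)
  assume "k \<notin> nu X M C I N m"
  then have eq: "power_image m k V = power_image m (k + 1) V" if "is_open V" for V
    using that unfolding nu_def by blast
  have "power_image m (k + q ^ m) U = power_image m ((k + 1) + q ^ m) U" if "is_open U" for U
  proof
    show "power_image m (k + q ^ m) U \<subseteq> power_image m ((k + 1) + q ^ m) U"
      by (rule power_image_shift[OF _ that]) (simp only: eq subset_refl)
    show "power_image m ((k + 1) + q ^ m) U \<subseteq> power_image m (k + q ^ m) U"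
      by (rule power_image_shift[OF _ that]) (simp only: eq subset_refl)
  qed
  moreover have "(k + 1) + q ^ m = (k + q ^ m) + 1" by simp
  ultimately have "power_image m (k + q ^ m) U = power_image m ((k + q ^ m) + 1) U" if "is_open U" for U
    using that by metis
  then show False using assms unfolding nu_def by blast
qed

lemma nu_mod:
  assumes "n \<in> nu X M C I N m"
  shows "n mod q ^ m \<in> nu X M C I N m"
proof -
  have "r + d * q ^ m \<in> nu X M C I N m \<Longrightarrow> r \<in> nu X M C I N m" for r d
  proof (induction d)
    case (Suc d)
    then show ?case using nu_shift[of "r + d * q ^ m" m] by (simp add: ac_simps)
  qed simp
  from this[of "n mod q ^ m" "n div q ^ m"] assms show ?thesis by (simp only: mod_div_mult_eq)
qed

end

section \<open>Residues of p-adic integers\<close>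

lemma padic_int_abelian_group:
  assumes "p > 0"
  shows "abelian_group (padic_int p)"
proof (rule abelian_groupI)
  have red: "(a mod int p ^ Suc k) mod int p ^ k = a mod int p ^ k" for a k
    by (rule mod_mod_cancel) simp
  have pos: "int p ^ k > 0" for k using assms by simp
  fix x y z assume x: "x \<in> carrier (padic_int p)" and y: "y \<in> carrier (padic_int p)"
  show "x \<oplus>\<^bsub>padic_int p\<^esub> y \<in> carrier (padic_int p)"
  proof -
    have "(x (Suc k) + y (Suc k)) mod int p ^ Suc k mod int p ^ k = (x k + y k) mod int p ^ k" for k
    proof -
      have "x (Suc k) mod int p ^ k = x k" "y (Suc k) mod int p ^ k = y k"
        using x y by (auto simp: padic_int_def)
      then show ?thesis unfolding red by (metis mod_add_eq)
    qed
    then show ?thesis using pos by (auto simp: padic_int_def)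
  qed
  show "x \<oplus>\<^bsub>padic_int p\<^esub> y = y \<oplus>\<^bsub>padic_int p\<^esub> x"
    by (simp add: padic_int_def add.commute)
  show "x \<oplus>\<^bsub>padic_int p\<^esub> y \<oplus>\<^bsub>padic_int p\<^esub> z = x \<oplus>\<^bsub>padic_int p\<^esub> (y \<oplus>\<^bsub>padic_int p\<^esub> z)"
    by (simp add: padic_int_def mod_simps add.assoc)
next
  show "\<zero>\<^bsub>padic_int p\<^esub> \<in> carrier (padic_int p)" using assms by (auto simp: padic_int_def)
next
  fix x assume x: "x \<in> carrier (padic_int p)"
  show "\<zero>\<^bsub>padic_int p\<^esub> \<oplus>\<^bsub>padic_int p\<^esub> x = x"
    using x by (auto simp: padic_int_def)
  have pos: "int p ^ k > 0" for k using assms by simp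
  let ?y = "\<lambda>k. (- x k) mod int p ^ k"
  have "?y (Suc k) mod int p ^ k = ?y k" for k
  proof -
    have "?y (Suc k) mod int p ^ k = (- x (Suc k)) mod int p ^ k"
      by (rule mod_mod_cancel) simp
    also have "\<dots> = (- (x (Suc k) mod int p ^ k)) mod int p ^ k" by (simp add: mod_simps)
    also have "x (Suc k) mod int p ^ k = x k" using x by (auto simp: padic_int_def)
    finally show ?thesis .
  qed
  then have "?y \<in> carrier (padic_int p)" using pos by (auto simp: padic_int_def)
  moreover have "?y \<oplus>\<^bsub>padic_int p\<^esub> x = \<zero>\<^bsub>padic_int p\<^esub>"
    by (simp add: padic_int_def mod_simps)
  ultimately show "\<exists>y\<in>carrier (padic_int p). y \<oplus>\<^bsub>padic_int p\<^esub> x = \<zero>\<^bsub>padic_int p\<^esub>" by blast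
qed

lemma padic_int_of_nat: "[n] \<cdot>\<^bsub>padic_int p\<^esub> \<one>\<^bsub>padic_int p\<^esub> = (\<lambda>k. int n mod int p ^ k)"
proof (induction n)
  case 0
  show ?case by (simp add: add_pow_def padic_int_def)
next
  case (Suc n)
  have "[Suc n] \<cdot>\<^bsub>padic_int p\<^esub> \<one>\<^bsub>padic_int p\<^esub> =
      [n] \<cdot>\<^bsub>padic_int p\<^esub> \<one>\<^bsub>padic_int p\<^esub> \<oplus>\<^bsub>padic_int p\<^esub> \<one>\<^bsub>padic_int p\<^esub>"
    by (simp add: add_pow_def)
  also have "\<dots> = (\<lambda>k. int (Suc n) mod int p ^ k)"
    unfolding Suc by (simp add: padic_int_def mod_simps add.commute)
  finally show ?case .
qed

text \<open>
  Component \<^term>\<open>k\<close> of a \<open>p\<close>-adic integer is its residue modulo \<open>p\<^sup>k\<close>, and every multiple of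
  \<open>p\<^sup>k\<close> has residue zero there.
\<close>
lemma padic_int_residue:
  assumes p: "p > 0" and x: "\<alpha> \<in> carrier (padic_int p)"
    and d: "\<alpha> \<ominus>\<^bsub>padic_int p\<^esub> [n] \<cdot>\<^bsub>padic_int p\<^esub> \<one>\<^bsub>padic_int p\<^esub>
          \<in> PIdl\<^bsub>padic_int p\<^esub> ([(p ^ k)] \<cdot>\<^bsub>padic_int p\<^esub> \<one>\<^bsub>padic_int p\<^esub>)"
  shows "\<alpha> k = int (n mod p ^ k)"
proof -
  interpret Z: abelian_group "padic_int p" by (rule padic_int_abelian_group[OF p])
  let ?n = "[n] \<cdot>\<^bsub>padic_int p\<^esub> \<one>\<^bsub>padic_int p\<^esub>"
  have "?n \<in> carrier (padic_int p)"
    unfolding padic_int_of_nat using p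
    by (auto simp: padic_int_def mod_mod_cancel)
  moreover obtain c where "\<alpha> \<ominus>\<^bsub>padic_int p\<^esub> ?n =
      c \<otimes>\<^bsub>padic_int p\<^esub> ([(p ^ k)] \<cdot>\<^bsub>padic_int p\<^esub> \<one>\<^bsub>padic_int p\<^esub>)"
    using d unfolding cgenideal_def by blast
  moreover have "\<alpha> \<ominus>\<^bsub>padic_int p\<^esub> \<beta> \<oplus>\<^bsub>padic_int p\<^esub> \<beta> = \<alpha>" if "\<beta> \<in> carrier (padic_int p)" for \<beta>
    using x that by (simp add: Z.minus_eq Z.add.m_assoc Z.l_neg)
  ultimately have "\<alpha> = c \<otimes>\<^bsub>padic_int p\<^esub> ([(p ^ k)] \<cdot>\<^bsub>padic_int p\<^esub> \<one>\<^bsub>padic_int p\<^esub>) \<oplus>\<^bsub>padic_int p\<^esub> ?n"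
    by metis
  then have "\<alpha> k = (c \<otimes>\<^bsub>padic_int p\<^esub> ([(p ^ k)] \<cdot>\<^bsub>padic_int p\<^esub> \<one>\<^bsub>padic_int p\<^esub>) \<oplus>\<^bsub>padic_int p\<^esub> ?n) k"
    by simp
  also have "\<dots> = int n mod int p ^ k"
    unfolding padic_int_of_nat by (simp add: padic_int_def)
  finally show ?thesis by (simp add: zmod_int)
qed

lemma padic_int_residue_le:
  assumes "\<alpha> \<in> carrier (padic_int p)" "j \<le> k"
  shows "\<alpha> j = \<alpha> k mod int p ^ j"
  using assms(2)
proof (induction k rule: dec_induct)
  case base
  then show ?case using assms(1) by (auto simp: padic_int_def)
next
  case (step k)
  have "\<alpha> (Suc k) mod int p ^ j = (\<alpha> (Suc k) mod int p ^ k) mod int p ^ j"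
    using step by (simp add: mod_mod_cancel le_imp_power_dvd)
  also have "\<alpha> (Suc k) mod int p ^ k = \<alpha> k" using assms(1) by (auto simp: padic_int_def)
  finally show ?case using step by simp
qed

text \<open>
  Distinct \<open>p\<close>-adic integers differ in some component, and then in all later ones.  Hence finitely
  many of them are separated by a single sufficiently late component, and the number of residues
  bounds their number.
\<close>
lemma finite_padic_if_bounded_residues:
  assumes S: "S \<subseteq> carrier (padic_int p)" and e: "e \<ge> 1"
    and bound: "\<And>m. m \<ge> 1 \<Longrightarrow> finite ((\<lambda>\<alpha>. \<alpha> (e * m)) ` S) \<and> card ((\<lambda>\<alpha>. \<alpha> (e * m)) ` S) \<le> L"
  shows "finite S"
proof (rule ccontr)
  assume "infinite S"
  then obtain A where A: "A \<subseteq> S" "finite A" "card A = Suc L"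
    using infinite_arbitrarily_large by blast
  have "\<exists>k. \<alpha> k \<noteq> \<beta> k" if "\<alpha> \<noteq> \<beta>" for \<alpha> \<beta> :: "nat \<Rightarrow> int" using that by auto
  then obtain sep where sep: "\<And>\<alpha> \<beta> :: nat \<Rightarrow> int. \<alpha> \<noteq> \<beta> \<Longrightarrow> \<alpha> (sep \<alpha> \<beta>) \<noteq> \<beta> (sep \<alpha> \<beta>)"
    by metis
  \<comment> \<open>A level late enough to separate all pairs from \<open>A\<close>; the successor ensures \<open>m \<ge> 1\<close>.\<close>
  define m where "m = Suc (Max (insert 0 ((\<lambda>(\<alpha>, \<beta>). sep \<alpha> \<beta>) ` (A \<times> A))))"
  have sep_le: "sep \<alpha> \<beta> \<le> e * m" if "\<alpha> \<in> A" "\<beta> \<in> A" for \<alpha> \<beta>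
  proof -
    have "sep \<alpha> \<beta> \<le> Max (insert 0 ((\<lambda>(\<alpha>, \<beta>). sep \<alpha> \<beta>) ` (A \<times> A)))"
      using that A by (intro Max_ge) auto
    also have "\<dots> \<le> m" by (simp add: m_def)
    also have "\<dots> \<le> e * m" using e by simp
    finally show ?thesis .
  qed
  have "inj_on (\<lambda>\<alpha>. \<alpha> (e * m)) A"
  proof (rule inj_onI, rule ccontr)
    fix \<alpha> \<beta> assume ab: "\<alpha> \<in> A" "\<beta> \<in> A" "\<alpha> (e * m) = \<beta> (e * m)" "\<alpha> \<noteq> \<beta>"
    then have "\<alpha> (sep \<alpha> \<beta>) = \<beta> (sep \<alpha> \<beta>)"
      using padic_int_residue_le[OF _ sep_le[OF ab(1,2)]] A(1) S by (metis subsetD)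
    then show False using sep ab by blast
  qed
  then have "Suc L = card ((\<lambda>\<alpha>. \<alpha> (e * m)) ` A)" using A by (simp add: card_image)
  also have "\<dots> \<le> card ((\<lambda>\<alpha>. \<alpha> (e * m)) ` S)"
    using A bound[of m] by (intro card_mono image_mono) (auto simp: m_def)
  also have "\<dots> \<le> L" using bound[of m] by (simp add: m_def)
  finally show False by simp
qed

section \<open>Finiteness\<close>

theorem proposition2p13:
  fixes p q e :: nat
    and X :: "('a, 'b) ringed_space"
    and I :: "'a set \<Rightarrow> 'b set"
    and M :: "('a, 'b, 'c) module_sheaf"
    and C :: "'a set \<Rightarrow> 'c \<Rightarrow> 'c"
    and N :: "'a set \<Rightarrow> 'c set"
  assumes "prime p"
    and "e \<ge> 1" and "q = p ^ e"
    and "noetherian_scheme X"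
    and "Fp_scheme p X"
    and "F_finite p X"
    and "quasi_coherent_ideal X I"
    and "locally_principal X I"
    and "cartier_module q X M C"
    and "coherent X M"
    and "is_submodule_sheaf X M N"
    and "coherent X (submodule_as_sheaf M N)"
    and "\<exists>L. \<forall>m\<ge>1. card (nu X M C I N m \<inter> {0..<q ^ m}) \<le> L"
  shows "finite (nu_infinity p q X M C I N)"
proof -
  interpret cartier_module_with_ideal X M q C I N
    using assms by unfold_locales
      (auto simp: noetherian_scheme_def is_scheme_def cartier_module_def quasi_coherent_ideal_def)
  obtain L where L: "\<And>m. m \<ge> 1 \<Longrightarrow> card (nu X M C I N m \<inter> {0..<q ^ m}) \<le> L"
    using assms(13) by blast
  have p: "p > 0" using assms(1) by (simp add: prime_gt_0_nat)
  have q: "q ^ m = p ^ (e * m)" for m by (simp add: assms(3) power_mult)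
  show ?thesis
  proof (rule finite_padic_if_bounded_residues[OF _ assms(2)])
    show "nu_infinity p q X M C I N \<subseteq> carrier (padic_int p)" by (auto simp: nu_infinity_def)
    fix m :: nat assume m: "m \<ge> 1"
    let ?R = "nu X M C I N m \<inter> {0..<q ^ m}"
    have sub: "(\<lambda>\<alpha>. \<alpha> (e * m)) ` nu_infinity p q X M C I N \<subseteq> int ` ?R"
    proof clarify
      fix \<alpha> assume "\<alpha> \<in> nu_infinity p q X M C I N"
      then obtain n where a: "\<alpha> \<in> carrier (padic_int p)" and n: "n \<in> nu X M C I N m"
        and d: "\<alpha> \<ominus>\<^bsub>padic_int p\<^esub> [n] \<cdot>\<^bsub>padic_int p\<^esub> \<one>\<^bsub>padic_int p\<^esub>
          \<in> PIdl\<^bsub>padic_int p\<^esub> ([(p ^ (e * m))] \<cdot>\<^bsub>padic_int p\<^esub> \<one>\<^bsub>padic_int p\<^esub>)"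
        using m unfolding nu_infinity_def q by blast
      have "\<alpha> (e * m) = int (n mod q ^ m)"
        using padic_int_residue[OF p a d] by (simp add: q)
      moreover have "n mod q ^ m \<in> ?R" using nu_mod[OF n] p by (simp add: q)
      ultimately show "\<alpha> (e * m) \<in> int ` ?R" by blast
    qed
    have "card ((\<lambda>\<alpha>. \<alpha> (e * m)) ` nu_infinity p q X M C I N) \<le> card (int ` ?R)"
      using sub by (intro card_mono) auto
    also have "\<dots> \<le> card ?R" by (intro card_image_le) auto
    also have "\<dots> \<le> L" by (rule L[OF m])
    finally show "finite ((\<lambda>\<alpha>. \<alpha> (e * m)) ` nu_infinity p q X M C I N) \<and>
        card ((\<lambda>\<alpha>. \<alpha> (e * m)) ` nu_infinity p q X M C I N) \<le> L"
      using finite_subset[OF sub] by auto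
  qed
qed

end
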